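(* For any convex body $K$ in $\mathbb{R}^2$, the maximum number of pairwise touching positive homothetic copies of $K$ is four; that is, there exist four pairwise touching positive homothetic copies of $K$, and no family of pairwise touching positive homothetic copies of $K$ has more than four members.
   Context: A convex body is a compact convex set with non-empty interior. A positive homothetic copy of $K\subset\mathbb{R}^d$ is a set of the form $\lambda K+t$ with $\lambda>0$ and $t\in\mathbb{R}^d$. Two sets in $\mathbb{R}^d$ touch each other if they intersect but their interiors are disjoint. *)

theory Defs
  imports "HOL-Analysis.Analysis"
begin

definition convex_body :: "'a::euclidean_space set \<Rightarrow> bool" where
  "convex_body K \<longleftrightarrow> compact K \<and> convex K \<and> interior K \<noteq> {}"

definition positive_homothetic_copy :: "'a::euclidean_space set \<Rightarrow> 'a set \<Rightarrow> bool" where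
  "positive_homothetic_copy K A \<longleftrightarrow> (\<exists>c t. c > 0 \<and> A = (\<lambda>x. c *\<^sub>R x + t) ` K)"

definition touch :: "'a::euclidean_space set \<Rightarrow> 'a set \<Rightarrow> bool" where
  "touch A B \<longleftrightarrow> A \<inter> B \<noteq> {} \<and> interior A \<inter> interior B = {}"

text \<open>
  Families are sets of sets. Repeated members need not be considered: a set with non-empty
  interior does not touch itself, so an indexed family of pairwise touching copies of a
  convex body is injective.
\<close>

definition touching_homothetic_family :: "'a::euclidean_space set \<Rightarrow> 'a set set \<Rightarrow> bool" where
  "touching_homothetic_family K F \<longleftrightarrow>
     (\<forall>A\<in>F. positive_homothetic_copy K A) \<and> pairwise touch F"

end

theory Submission
  imports Defs
begin

text \<open>
  \<^emph>\<open>Four copies exist.\<close> Translate \<open>K\<close> along a diameter, so that the two translates meet in a single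
  point \<open>x\<close>. On either side of the diameter there is a third translate touching both; these two do
  not overlap. If both contain \<open>x\<close>, the four translates touch pairwise. Otherwise some triple of
  pairwise touching translates has no common point, and encloses a gap. The largest copy of \<open>K\<close>
  that fits into the gap touches all three (\<open>homothet_touching_three\<close>), as a copy
  missing one of them could be enlarged from the contact point of the other two.

  \<^emph>\<open>Five copies cannot touch pairwise.\<close> Joining interior points of the copies through contact points
  draws the complete graph on five vertices with once-bent edges. In such a drawing, two edges without
  a common vertex meet (\<open>crossing_bent_complete_graph\<close>): for points in general position the
  number of such crossings is odd when all edges are straight, and bending an edge does not change its
  parity. As the interiors are disjoint, the edges can only meet in a point \<open>q\<close> that
  belongs to four of the copies. The preimages of \<open>q\<close> in \<open>K\<close> under these four homotheties are four
  points at which \<open>K\<close> spans cones of directions with disjoint interiors. The angles of the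
  quadrilateral that they span already fill all directions, which leaves no room: \<open>K\<close> is a parallelogram with these vertices
  (\<open>parallelogram_of_crossing_diagonals\<close>). In suitable coordinates all five copies are then axis-parallel
  squares. Pairwise meeting ones have a common point, around which
  each takes up at least one of the four quadrants, so two of the five overlap
  (\<open>five_boxes_overlap\<close>).
\<close>

section \<open>Homothetic copies of convex bodies\<close>

lemma interior_homothet:
  fixes K :: "'a::euclidean_space set"
  assumes "c \<noteq> 0"
  shows "interior ((\<lambda>x. c *\<^sub>R x + t) ` K) = (\<lambda>x. c *\<^sub>R x + t) ` interior K"
proof -
  have eq: "(\<lambda>x. c *\<^sub>R x + t) ` S = (+) t ` ((*\<^sub>R) c ` S)" for S :: "'a set"
    by (auto simp: image_image add.commute)
  have "linear ((*\<^sub>R) c :: 'a \<Rightarrow> 'a)" "inj ((*\<^sub>R) c :: 'a \<Rightarrow> 'a)"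
    using assms by (auto simp: inj_on_def linear_scaleR)
  then show ?thesis
    unfolding eq by (simp add: interior_translation interior_injective_linear_image)
qed

lemma convex_homothet:
  assumes "convex K"
  shows "convex ((\<lambda>x. c *\<^sub>R x + t) ` K)"
proof -
  have eq: "(\<lambda>x. c *\<^sub>R x + t) ` K = (+) t ` ((*\<^sub>R) c ` K)"
    by (auto simp: image_image add.commute)
  show ?thesis
    unfolding eq by (intro convex_translation convex_scaling assms)
qed

lemma convex_body_homothet:
  fixes K :: "'a::euclidean_space set"
  assumes "convex_body K" "c > 0"
  shows "convex_body ((\<lambda>x. c *\<^sub>R x + t) ` K)"
proof -
  have "compact ((\<lambda>x. c *\<^sub>R x + t) ` K)"
    by (rule compact_continuous_image) (use assms in \<open>auto simp: convex_body_def intro!: continuous_intros\<close>)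
  then show ?thesis
    using assms convex_homothet[of K c t] interior_homothet[of c t K] by (auto simp: convex_body_def)
qed

lemma closure_interior_convex_body:
  "convex_body K \<Longrightarrow> closure (interior K) = K"
  by (simp add: convex_body_def convex_closure_interior compact_imp_closed)

lemma interior_disjoint_convex_body:
  assumes "convex_body B" "interior A \<inter> interior B = {}"
  shows "interior A \<inter> B = {}"
  using open_Int_closure_eq_empty[of "interior A" "interior B"] closure_interior_convex_body[OF assms(1)]
    assms(2) by simp

section \<open>Filling the gap between three bodies\<close>

text \<open>A line strictly separating \<open>A \<inter> B \<inter> T\<close> from \<open>C \<inter> T\<close> would meet \<open>T\<close> in a connected set that
  is split by the closed sets \<open>A\<close> and \<open>B\<close> into two non-empty disjoint pieces.\<close>

lemma convex_cover_common_point: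
  fixes T :: "'a::euclidean_space set"
  assumes "compact A" "convex A" "compact B" "convex B" "compact C" "convex C"
    and T: "compact T" "convex T" "T \<subseteq> A \<union> B \<union> C"
    and AB: "A \<inter> B \<inter> T \<noteq> {}" and AC: "A \<inter> C \<inter> T \<noteq> {}" and BC: "B \<inter> C \<inter> T \<noteq> {}"
  shows "A \<inter> B \<inter> C \<noteq> {}"
proof
  assume none: "A \<inter> B \<inter> C = {}"
  have "\<exists>a b. (\<forall>x\<in>A \<inter> B \<inter> T. inner a x < b) \<and> (\<forall>x\<in>C \<inter> T. inner a x > b)"
    using assms none
    by (intro separating_hyperplane_compact_closed)
      (auto intro!: convex_Int compact_Int compact_imp_closed)
  then obtain a b where lo: "\<And>x. x \<in> A \<inter> B \<inter> T \<Longrightarrow> inner a x < b"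
    and hi: "\<And>x. x \<in> C \<inter> T \<Longrightarrow> inner a x > b" by blast
  obtain p q r where p: "p \<in> A \<inter> B \<inter> T" and q: "q \<in> A \<inter> C \<inter> T" and r: "r \<in> B \<inter> C \<inter> T"
    using AB AC BC by blast
  define H where "H = {x. inner a x = b} \<inter> T"
  have "\<exists>z\<in>A \<inter> T. inner a z = b"
    using p q lo[of p] hi[of q] assms
    by (intro connected_ivt_hyperplane[of "A \<inter> T" p q]) (auto intro!: convex_connected convex_Int)
  then have A: "A \<inter> H \<noteq> {}" by (auto simp: H_def)
  have "\<exists>z\<in>B \<inter> T. inner a z = b"
    using p r lo[of p] hi[of r] assms
    by (intro connected_ivt_hyperplane[of "B \<inter> T" p r]) (auto intro!: convex_connected convex_Int)
  then have B: "B \<inter> H \<noteq> {}" by (auto simp: H_def)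
  have "connected H"
    unfolding H_def using T by (intro convex_connected convex_Int convex_hyperplane)
  moreover have "H \<subseteq> A \<union> B" using T(3) hi by (force simp: H_def)
  moreover have "A \<inter> B \<inter> H = {}" using lo by (force simp: H_def)
  ultimately show False
    using A B assms(1,3) unfolding connected_closed by (meson compact_imp_closed)
qed

text \<open>A point of \<open>B\<close> in the dilated copy would stay in \<open>B\<close> when moved back towards \<open>p\<close>.\<close>

lemma dilate_avoiding:
  fixes K :: "'a::euclidean_space set"
  assumes "convex_body B" "p \<in> B" "e > 0" "c > 0"
    and "interior ((\<lambda>x. c *\<^sub>R x + s) ` K) \<inter> interior B = {}"
  shows "interior ((\<lambda>x. ((1 + e) * c) *\<^sub>R x + ((1 + e) *\<^sub>R (s - p) + p)) ` K) \<inter> interior B = {}"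
proof -
  have dis: "(\<lambda>x. c *\<^sub>R x + s) ` interior K \<inter> B = {}"
    using interior_disjoint_convex_body[OF assms(1,5)] assms(4) by (simp add: interior_homothet)
  have False if k: "k \<in> interior K" and w: "((1 + e) * c) *\<^sub>R k + ((1 + e) *\<^sub>R (s - p) + p) \<in> B" for k
  proof -
    define w' where "w' = ((1 + e) * c) *\<^sub>R k + ((1 + e) *\<^sub>R (s - p) + p)"
    have "(1 - 1 / (1 + e)) *\<^sub>R p + (1 / (1 + e)) *\<^sub>R w' \<in> B"
      using assms(1,2,3) w unfolding convex_body_def w'_def[symmetric]
      by (intro convexD_alt) auto
    moreover have "(1 - 1 / (1 + e)) *\<^sub>R p + (1 / (1 + e)) *\<^sub>R w'
      = p + (1 / (1 + e)) *\<^sub>R ((1 + e) *\<^sub>R (c *\<^sub>R k + s - p))"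
      by (simp add: w'_def algebra_simps)
    moreover have "\<dots> = c *\<^sub>R k + s" using assms(3) by simp
    ultimately show False using dis k by auto
  qed
  then have "(\<lambda>x. ((1 + e) * c) *\<^sub>R x + ((1 + e) *\<^sub>R (s - p) + p)) ` interior K \<inter> interior B = {}"
    using interior_subset by fastforce
  moreover have "(1 + e) * c \<noteq> 0" using assms by simp
  ultimately show ?thesis by (simp add: interior_homothet)
qed

text \<open>The three segments joining the contact points lie in the bodies, so they close off a
  triangle which, by \<open>convex_cover_common_point\<close>, is not covered by the bodies. A largest homothetic copy of
  \<open>K\<close> in the uncovered part touches all three: if it missed \<open>B i\<close>, then dilating it slightly from
  the contact point of the other two bodies would keep it out of all of them, and hence inside the
  triangle.\<close>

lemma homothet_touching_three:
  fixes K :: "(real^2) set" and B :: "nat \<Rightarrow> (real^2) set"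
  assumes K: "convex_body K" and B: "\<And>i. i < 3 \<Longrightarrow> convex_body (B i)"
    and meet: "\<And>i j. i < 3 \<Longrightarrow> j < 3 \<Longrightarrow> B i \<inter> B j \<noteq> {}"
    and none: "B 0 \<inter> B 1 \<inter> B 2 = {}"
  shows "\<exists>L. positive_homothetic_copy K L \<and> (\<forall>i<3. touch L (B i))"
proof -
  obtain p :: "nat \<Rightarrow> real^2" where p: "\<And>i j. i < 3 \<Longrightarrow> j < 3 \<Longrightarrow> i \<noteq> j \<Longrightarrow> p i \<in> B j"
  proof -
    obtain a b c where abc: "a \<in> B 1 \<inter> B 2" "b \<in> B 0 \<inter> B 2" "c \<in> B 0 \<inter> B (1::nat)"
      using meet[of 1 2] meet[of 0 2] meet[of 0 1] by auto
    have "(if i = 0 then a else if i = 1 then b else c) \<in> B j" if "i < 3" "j < 3" "i \<noteq> j" for i j :: nat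
      using that abc by (auto simp: less_Suc_eq numeral_3_eq_3 numeral_2_eq_2)
    then show ?thesis by (rule that)
  qed
  define T where "T = convex hull {p 0, p 1, p 2}"
  have T: "compact T" "convex T" by (auto simp: T_def compact_convex_hull)
  have comp: "compact (B i)" "convex (B i)" if "i < 3" for i using B[OF that] by (auto simp: convex_body_def)
  have segs: "closed_segment (p 0) (p 1) \<subseteq> B 2" "closed_segment (p 1) (p 2) \<subseteq> B 0"
    "closed_segment (p 2) (p 0) \<subseteq> B 1"
    using p[of 0 2] p[of 1 2] p[of 1 0] p[of 2 0] p[of 2 1] p[of 0 1] comp by (simp_all add: closed_segment_subset)
  have fr: "frontier T \<subseteq> B 0 \<union> B 1 \<union> B 2"
    unfolding T_def using segs by (subst frontier_of_triangle) auto
  have pT: "p 0 \<in> T" "p 1 \<in> T" "p 2 \<in> T" unfolding T_def by (auto intro: hull_inc)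
  have "\<not> T \<subseteq> B 0 \<union> B 1 \<union> B 2"
  proof
    assume "T \<subseteq> B 0 \<union> B 1 \<union> B 2"
    then have "B 0 \<inter> B 1 \<inter> B 2 \<noteq> {}"
      using comp T p[of 0 1] p[of 0 2] p[of 1 0] p[of 1 2] p[of 2 0] p[of 2 1] pT
      by (rule_tac convex_cover_common_point[where T = T]) auto
    then show False using none by simp
  qed
  then obtain z where z: "z \<in> T" "z \<notin> B 0 \<union> B 1 \<union> B 2" by blast
  have op: "open (interior T - (B 0 \<union> B 1 \<union> B 2))"
    using comp by (intro open_Diff open_interior closed_Un) (auto intro: compact_imp_closed)
  have "z \<in> interior T" using z fr closure_subset[of T] by (auto simp: frontier_def)
  then obtain r where r: "r > 0" "ball z r \<subseteq> interior T - (B 0 \<union> B 1 \<union> B 2)"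
    using op z unfolding open_contains_ball by blast
  obtain M where M: "M > 0" "\<And>k. k \<in> K \<Longrightarrow> norm k \<le> M"
    using K unfolding convex_body_def by (meson bounded_pos compact_imp_bounded)
  obtain k0 where k0: "k0 \<in> interior K" using K by (auto simp: convex_body_def)
  define S where "S = {(c, s). 0 \<le> c \<and> (\<forall>k\<in>K. c *\<^sub>R k + s \<in> T) \<and>
    (\<forall>i\<in>{..<3}. \<forall>k\<in>interior K. c *\<^sub>R k + s \<notin> interior (B i))}"
  have SI: "(c, s) \<in> S" if "c > 0" "(\<lambda>x. c *\<^sub>R x + s) ` K \<subseteq> T"
    "\<And>i. i < 3 \<Longrightarrow> interior ((\<lambda>x. c *\<^sub>R x + s) ` K) \<inter> interior (B i) = {}" for c s
    using that by (fastforce simp: S_def interior_homothet disjoint_iff image_subset_iff)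
  have "closed S"
  proof -
    have eq: "S = {q. 0 \<le> fst q} \<inter> (\<Inter>k\<in>K. (\<lambda>q. fst q *\<^sub>R k + snd q) -` T)
      \<inter> (\<Inter>i\<in>{..<3}. \<Inter>k\<in>interior K. (\<lambda>q. fst q *\<^sub>R k + snd q) -` (- interior (B i)))"
      by (auto simp: S_def)
    show ?thesis unfolding eq using T(1)
      by (intro closed_Int closed_INT ballI closed_vimage closed_Collect_le continuous_intros)
        (auto intro: compact_imp_closed)
  qed
  moreover have "bounded S"
  proof -
    obtain R where R: "\<And>x. x \<in> T \<Longrightarrow> norm x \<le> R"
      using T(1) by (meson bounded_iff compact_imp_bounded)
    \<comment> \<open>Two distinct points of \<open>K\<close> bound the ratio.\<close>
    obtain d where d: "d > 0" "ball k0 d \<subseteq> K" using k0 by (auto simp: mem_interior)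
    define k1 where "k1 = k0 + (d / 2) *\<^sub>R axis 1 (1::real)"
    have k1: "k1 \<in> K" using d by (intro subsetD[OF d(2)]) (auto simp: k1_def dist_norm)
    have "norm c \<le> 4 * R / d \<and> norm s \<le> R + 4 * R / d * M" if "(c, s) \<in> S" for c s
    proof -
      have c: "c \<ge> 0" and cs: "\<And>k. k \<in> K \<Longrightarrow> norm (c *\<^sub>R k + s) \<le> R" using that R by (auto simp: S_def)
      have k0': "k0 \<in> K" using k0 interior_subset by blast
      have "c * (d / 2) = norm ((c *\<^sub>R k1 + s) - (c *\<^sub>R k0 + s))"
        using c d by (simp add: k1_def algebra_simps)
      also have "\<dots> \<le> 2 * R" using norm_triangle_ineq4[of "c *\<^sub>R k1 + s" "c *\<^sub>R k0 + s"] cs[OF k1] cs[OF k0'] by simp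
      finally have cb: "c \<le> 4 * R / d" using d by (simp add: field_simps)
      have "norm s \<le> norm (c *\<^sub>R k0 + s) + norm (c *\<^sub>R k0)"
        by (metis add.commute norm_minus_commute norm_triangle_sub add_diff_cancel_left')
      also have "\<dots> \<le> R + c * M" using cs[OF k0'] M(2)[OF k0'] c by (auto intro!: add_mono mult_left_mono)
      also have "\<dots> \<le> R + 4 * R / d * M" using cb M by (intro add_left_mono mult_right_mono) auto
      finally show ?thesis using cb c by simp
    qed
    then have "S \<subseteq> cball 0 (4 * R / d) \<times> cball 0 (R + 4 * R / d * M)" by auto
    then show ?thesis
      by (rule bounded_subset[rotated]) (intro bounded_Times bounded_cball)
  qed
  ultimately have "compact S" by (simp add: compact_eq_bounded_closed)
  have small: "(r / (2 * M), z) \<in> S"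
  proof (rule SI)
    show "r / (2 * M) > 0" using r M by simp
    have "(\<lambda>x. (r / (2 * M)) *\<^sub>R x + z) ` K \<subseteq> ball z r"
    proof clarify
      fix k assume "k \<in> K"
      have "norm ((r / (2 * M)) *\<^sub>R k) = r / (2 * M) * norm k" using M(1) r(1) by simp
      also have "\<dots> \<le> r / (2 * M) * M"
        using M(1) r(1) by (intro mult_left_mono M(2)[OF \<open>k \<in> K\<close>]) simp
      also have "\<dots> < r" using M(1) r by simp
      finally show "(r / (2 * M)) *\<^sub>R k + z \<in> ball z r" by (simp add: dist_norm)
    qed
    then have sub: "(\<lambda>x. (r / (2 * M)) *\<^sub>R x + z) ` K \<subseteq> interior T - (B 0 \<union> B 1 \<union> B 2)"
      using r by blast
    then show "(\<lambda>x. (r / (2 * M)) *\<^sub>R x + z) ` K \<subseteq> T" using interior_subset by blast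
    show "interior ((\<lambda>x. (r / (2 * M)) *\<^sub>R x + z) ` K) \<inter> interior (B i) = {}" if "i < 3" for i
      using sub interior_subset[of "(\<lambda>x. (r / (2 * M)) *\<^sub>R x + z) ` K"] interior_subset[of "B i"] that
      by (fastforce simp: less_Suc_eq numeral_3_eq_3 numeral_2_eq_2)
  qed
  obtain q where q: "q \<in> S" "\<And>q'. q' \<in> S \<Longrightarrow> fst q' \<le> fst q"
  proof -
    have "S \<noteq> {}" "continuous_on S fst" using small by (auto intro: continuous_on_fst continuous_on_id)
    then show ?thesis using continuous_attains_sup[OF \<open>compact S\<close>, of fst] that by blast
  qed
  obtain c s where cs: "q = (c, s)" by (cases q)
  have cpos: "c > 0" using q(2)[OF small] r M cs by (smt (verit) divide_pos_pos fst_conv)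
  define L where "L = (\<lambda>x. c *\<^sub>R x + s) ` K"
  have L: "convex_body L" unfolding L_def by (rule convex_body_homothet[OF K cpos])
  have LT: "L \<subseteq> T" using q(1) by (auto simp: L_def S_def cs)
  have LB: "interior L \<inter> interior (B i) = {}" if "i < 3" for i
    using q(1) that cpos by (auto simp: L_def S_def cs interior_homothet)
  have "L \<inter> B i \<noteq> {}" if i: "i < 3" for i
  proof
    assume dis: "L \<inter> B i = {}"
    define u where "u = c *\<^sub>R k0 + s"
    have "u \<in> interior L" using k0 cpos by (auto simp: L_def interior_homothet u_def)
    then have "u \<in> interior T" using LT interior_mono by blast
    then obtain d where d: "d > 0" "ball u d \<subseteq> T" by (auto simp: mem_interior)
    obtain g where g: "g > 0" "\<And>x y. x \<in> L \<Longrightarrow> y \<in> B i \<Longrightarrow> g \<le> dist x y"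
      using separate_compact_closed[of L "B i"] dis L comp[OF i] by (auto simp: convex_body_def compact_imp_closed)
    obtain N where N: "N > 0" "\<And>x. x \<in> L \<Longrightarrow> norm (x - p i) \<le> N"
    proof -
      have "compact L" using L by (simp add: convex_body_def)
      then have "bounded ((\<lambda>x. x - p i) ` L)"
        by (intro compact_imp_bounded compact_continuous_image continuous_intros)
      then show ?thesis using that unfolding bounded_pos by auto
    qed
    \<comment> \<open>So small a dilation keeps the copy away from \<open>B i\<close>, and the image of \<open>k0\<close> inside \<open>T\<close>.\<close>
    define e where "e = min d g / (2 * N)"
    have e: "e > 0" using d g N by (simp add: e_def)
    have eN: "e * N < d" "e * N < g" using d g N by (auto simp: e_def)
    define c' s' where "c' = (1 + e) * c" and "s' = (1 + e) *\<^sub>R (s - p i) + p i"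
    define L' where "L' = (\<lambda>x. c' *\<^sub>R x + s') ` K"
    have c': "c' > c" using e cpos by (simp add: c'_def)
    have L': "convex_body L'" unfolding L'_def using c' cpos by (intro convex_body_homothet[OF K]) simp
    have near: "dist (c *\<^sub>R k + s) (c' *\<^sub>R k + s') \<le> e * N" if "k \<in> K" for k
    proof -
      have "(c' *\<^sub>R k + s') - (c *\<^sub>R k + s) = e *\<^sub>R ((c *\<^sub>R k + s) - p i)"
        by (simp add: c'_def s'_def algebra_simps)
      moreover have "norm ((c *\<^sub>R k + s) - p i) \<le> N" using that by (intro N(2)) (auto simp: L_def)
      ultimately show ?thesis using e by (simp add: dist_norm norm_minus_commute mult_left_mono)
    qed
    have avoid: "interior L' \<inter> interior (B j) = {}" if j: "j < 3" for j
    proof (cases "j = i")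
      case True
      have "L' \<inter> B i = {}"
      proof -
        have False if k: "k \<in> K" and "c' *\<^sub>R k + s' \<in> B i" for k
          using g(2)[of "c *\<^sub>R k + s" "c' *\<^sub>R k + s'"] near[OF k] eN that by (auto simp: L_def)
        then show ?thesis by (auto simp: L'_def)
      qed
      then show ?thesis using True interior_subset by blast
    next
      case False
      then show ?thesis unfolding L'_def c'_def s'_def
        using p[OF i j] B[OF j] LB[OF j] e cpos by (rule_tac dilate_avoiding) (auto simp: L_def)
    qed
    have "interior L' \<subseteq> T"
    proof (rule ccontr)
      assume "\<not> interior L' \<subseteq> T"
      moreover have "c' *\<^sub>R k0 + s' \<in> interior L' \<inter> T"
      proof -
        have "dist u (c' *\<^sub>R k0 + s') < d"
          using near[of k0] k0 interior_subset[of K] eN by (auto simp: u_def)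
        then show ?thesis using d k0 c' cpos by (auto simp: L'_def interior_homothet)
      qed
      moreover have "connected (interior L')"
        using L' by (intro convex_connected convex_interior) (simp add: convex_body_def)
      ultimately have "interior L' \<inter> frontier T \<noteq> {}"
        by (intro connected_Int_frontier) auto
      then obtain w where w: "w \<in> interior L'" "w \<in> B 0 \<union> B 1 \<union> B 2"
        using fr by blast
      have "interior L' \<inter> B j = {}" if "j < 3" for j
        using interior_disjoint_convex_body[OF B avoid] that by blast
      from this[of 0] this[of 1] this[of 2] show False using w by auto
    qed
    then have "L' \<subseteq> T"
      using closure_interior_convex_body[OF L'] T(1) by (metis closure_minimal compact_imp_closed)
    then have "(c', s') \<in> S"
      using avoid c' cpos by (intro SI) (auto simp: L'_def)
    then show False using q(2)[of "(c', s')"] c' cs by simp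
  qed
  then have "\<forall>i<3. touch L (B i)" using LB by (auto simp: touch_def)
  moreover have "positive_homothetic_copy K L"
    using cpos by (auto simp: positive_homothetic_copy_def L_def)
  ultimately show ?thesis by blast
qed

section \<open>Four touching copies\<close>

lemma touch_sym: "touch A B \<Longrightarrow> touch B A"
  by (auto simp: touch_def)

lemma convex_body_not_touch_self: "convex_body A \<Longrightarrow> \<not> touch A A"
  by (auto simp: touch_def convex_body_def)

lemma convex_body_homothetic_copy:
  "convex_body K \<Longrightarrow> positive_homothetic_copy K A \<Longrightarrow> convex_body A"
  by (auto simp: positive_homothetic_copy_def intro: convex_body_homothet)

lemma touching_family_of_sequence:
  assumes "convex_body K" "\<And>i. i < m \<Longrightarrow> positive_homothetic_copy K (A i)"
    and "\<And>i j. i < j \<Longrightarrow> j < m \<Longrightarrow> touch (A i) (A j)"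
  shows "touching_homothetic_family K (A ` {..<m}) \<and> card (A ` {..<m}) = m"
proof -
  have t: "touch (A i) (A j)" if "i < m" "j < m" "i \<noteq> j" for i j
    using assms(3)[of i j] assms(3)[of j i] that touch_sym by (metis linorder_neqE_nat)
  have "inj_on A {..<m}"
  proof (rule inj_onI)
    fix i j assume ij: "i \<in> {..<m}" "j \<in> {..<m}" "A i = A j"
    show "i = j"
      using t[of i j] ij convex_body_not_touch_self[of "A j"]
        convex_body_homothetic_copy[OF assms(1) assms(2)[of j]] by auto
  qed
  then have "card (A ` {..<m}) = m" by (simp add: card_image)
  then show ?thesis
    using assms(2) t unfolding touching_homothetic_family_def pairwise_def by auto
qed

lemma touching_triple_extends:
  fixes K :: "(real^2) set"
  assumes K: "convex_body K" and hom: "\<And>i. i < 3 \<Longrightarrow> positive_homothetic_copy K (B i)"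
    and t: "touch (B 0) (B 1)" "touch (B 0) (B 2)" "touch (B 1) (B 2)"
    and none: "B 0 \<inter> B 1 \<inter> B (2::nat) = {}"
  shows "\<exists>F. touching_homothetic_family K F \<and> card F = 4"
proof -
  have cases3: "i = 0 \<or> i = 1 \<or> i = 2" if "i < 3" for i :: nat using that by auto
  have body: "convex_body (B i)" if "i < 3" for i
    using hom[OF that] K convex_body_homothetic_copy by blast
  have meet: "B i \<inter> B j \<noteq> {}" if "i < 3" "j < 3" for i j
  proof (cases "i = j")
    case True
    then show ?thesis using body[OF that(1)] by (auto simp: convex_body_def)
  next
    case False
    then show ?thesis using cases3[OF that(1)] cases3[OF that(2)] t by (auto simp: touch_def)
  qed
  obtain L where L: "positive_homothetic_copy K L" "\<forall>i<3. touch L (B i)"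
    using homothet_touching_three[where K = K and B = B] K body meet none by blast
  define A where "A = B(3 := L)"
  have "touching_homothetic_family K (A ` {..<4}) \<and> card (A ` {..<4}) = 4"
  proof (rule touching_family_of_sequence[OF K])
    show "positive_homothetic_copy K (A i)" if "i < 4" for i
      using that hom L(1) by (auto simp: A_def)
    show "touch (A i) (A j)" if "i < j" "j < 4" for i j
    proof (cases "j = 3")
      case True
      then show ?thesis using that L(2) touch_sym by (auto simp: A_def)
    next
      case False
      then have "i = 0 \<and> j = 1 \<or> i = 0 \<and> j = 2 \<or> i = 1 \<and> j = 2" using that by auto
      then show ?thesis using t by (auto simp: A_def)
    qed
  qed
  then show ?thesis by blast
qed

text \<open>Moving from the maximiser \<open>t\<close> towards a higher point of \<open>D'\<close> stays in \<open>D\<close> for a while.\<close>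

lemma maximum_beyond_interior:
  fixes D D' :: "'a::euclidean_space set"
  assumes "convex D'" "t \<in> interior D" "t \<in> D'" "\<And>w. w \<in> D \<inter> D' \<Longrightarrow> inner n w \<le> inner n t"
    and w: "w \<in> D'"
  shows "inner n w \<le> inner n t"
proof (rule ccontr)
  assume gt: "\<not> inner n w \<le> inner n t"
  obtain d where d: "d > 0" "ball t d \<subseteq> D" using assms(2) by (auto simp: mem_interior)
  define N where "N = norm (w - t) + 1"
  define e where "e = min 1 (d / (2 * N))"
  have np: "N > 0" by (simp add: N_def add_nonneg_pos)
  then have e: "e > 0" "e \<le> 1" using d by (auto simp: e_def)
  have "e * norm (w - t) \<le> d / (2 * N) * N"
    using d(1) np by (intro mult_mono) (auto simp: e_def N_def)
  also have "\<dots> < d" using d(1) np by simp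
  finally have ed: "e * norm (w - t) < d" .
  have "t + e *\<^sub>R (w - t) \<in> D"
    using e ed by (intro subsetD[OF d(2)]) (simp add: dist_norm)
  moreover have "t + e *\<^sub>R (w - t) = (1 - e) *\<^sub>R t + e *\<^sub>R w" by (simp add: algebra_simps)
  then have "t + e *\<^sub>R (w - t) \<in> D'"
    using e assms(1,3) w by (auto intro!: convexD_alt)
  ultimately have "inner n (t + e *\<^sub>R (w - t)) \<le> inner n t" using assms(4) by blast
  then have "e * (inner n w - inner n t) \<le> 0" by (simp add: inner_add_right inner_diff_right)
  then show False using e gt by (simp add: mult_le_0_iff)
qed

lemma interior_not_maximum:
  fixes D :: "'a::euclidean_space set"
  assumes "t \<in> interior D" "n \<noteq> 0"
  shows "\<exists>w\<in>D. inner n w > inner n t"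
proof (rule ccontr)
  assume "\<not> ?thesis"
  then have "inner n (t + n) \<le> inner n t"
    using assms by (rule_tac maximum_beyond_interior[of UNIV t D n]) (auto simp: not_less)
  then have "inner n n \<le> 0" by (simp add: inner_add_right)
  moreover have "inner n n > 0" using assms(2) by (subst inner_gt_zero_iff)
  ultimately show False by linarith
qed

text \<open>Let \<open>a\<close> join the ends of a diameter of \<open>K\<close>, ending at \<open>x\<close>. As the points of \<open>K\<close> and of its
  translate by \<open>a\<close> are at distance at most \<open>norm a\<close> from both ends, the two translates meet only in
  \<open>x\<close>. Translates of \<open>K\<close> by \<open>p\<close> and \<open>q\<close> touch iff \<open>p - q\<close> is on the boundary of the difference body
  \<open>D\<close>. A point \<open>t\<close> of \<open>D\<close> and of its translate by \<open>a\<close> that is farthest from the line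
  through \<open>a\<close> therefore gives a third translate touching both, and so does the reflected point
  \<open>a - t\<close>. The translates by \<open>t\<close> and \<open>a - t\<close> do not overlap, since otherwise \<open>t\<close>, the midpoint of
  \<open>2 t - a\<close> and \<open>a\<close>, would be interior to \<open>D\<close>. Now either one of the two triples
  has no common point and the gap between its members takes a fourth copy, or all four translates
  contain \<open>x\<close>.\<close>

lemma four_touching_copies:
  fixes K :: "(real^2) set"
  assumes K: "convex_body K"
  shows "\<exists>F. touching_homothetic_family K F \<and> card F = 4"
proof -
  have Kc: "compact K" "convex K" "interior K \<noteq> {}" using K by (auto simp: convex_body_def)
  define D where "D = {u - v | u v. u \<in> K \<and> v \<in> K}"
  define tr where "tr p = (\<lambda>u. 1 *\<^sub>R u + p) ` K" for p
  have "D = (\<Union>u\<in>K. \<Union>v\<in>K. {u - v})" by (auto simp: D_def)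
  then have D: "compact D" "convex D"
    using Kc compact_differences[of K K] convex_differences[of K K] unfolding D_def by metis+
  have Dm: "- w \<in> D" if "w \<in> D" for w using that unfolding D_def by (auto intro: minus_diff_eq)
  have intD: "v - u \<in> interior D" if "v \<in> interior K" "u \<in> K" for u v
  proof (rule interiorI)
    show "open ((\<lambda>w. w - u) ` interior K)" by (intro open_translation_subtract open_interior)
    show "v - u \<in> (\<lambda>w. w - u) ` interior K" using that by blast
    show "(\<lambda>w. w - u) ` interior K \<subseteq> D" using that interior_subset unfolding D_def by blast
  qed
  have intDm: "- w \<in> interior D" if "w \<in> interior D" for w
  proof -
    have "uminus ` D = D" using Dm by (metis (no_types, lifting) image_subsetI minus_minus image_iff subsetI subset_antisym)
    then have "uminus ` interior D = interior D" using interior_negations[of D] by simp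
    then show ?thesis using that by blast
  qed
  have hom: "positive_homothetic_copy K (tr p)" for p
    unfolding positive_homothetic_copy_def tr_def by (rule exI[of _ 1], rule exI[of _ p]) simp
  have disjoint: "interior (tr p) \<inter> interior (tr q) = {}" if "p - q \<notin> interior D" for p q
  proof -
    have False if "u \<in> interior K" "v \<in> interior K" "u + p = v + q" for u v
    proof -
      have "v - u = p - q" using that(3) by (simp add: algebra_simps)
      moreover have "u \<in> K" using that(1) interior_subset by blast
      ultimately show False using intD[OF that(2), of u] \<open>p - q \<notin> interior D\<close> by simp
    qed
    moreover have "interior (tr r) = (\<lambda>u. u + r) ` interior K" for r
      using interior_homothet[of 1 r K] by (simp add: tr_def)
    ultimately show ?thesis by auto
  qed
  have tt: "touch (tr p) (tr q)" if pq: "p - q \<in> D" "p - q \<notin> interior D" for p q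
  proof -
    obtain u v where uv: "u \<in> K" "v \<in> K" "p - q = u - v" using pq(1) unfolding D_def by blast
    then have "1 *\<^sub>R v + p = 1 *\<^sub>R u + q" by (simp add: algebra_simps)
    then have "tr p \<inter> tr q \<noteq> {}" using uv unfolding tr_def by blast
    then show ?thesis using disjoint[OF pq(2)] by (simp add: touch_def)
  qed
  obtain x y where xy: "x \<in> K" "y \<in> K" and diam: "\<And>u v. u \<in> K \<Longrightarrow> v \<in> K \<Longrightarrow> dist u v \<le> dist x y"
    using compact_sup_maxdistance[OF Kc(1)] Kc(3) interior_subset by (metis bot.extremum_uniqueI)
  define a where "a = x - y"
  have diam': "norm w \<le> norm a" if "w \<in> D" for w
    using that diam unfolding D_def a_def dist_norm by blast
  have "a \<noteq> 0"
  proof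
    assume "a = 0"
    then have "D \<subseteq> {0}" using diam' by auto
    then have "interior D = {}" using interior_mono[of D "{0}"] by simp
    then show False using intD Kc(3) interior_subset by blast
  qed
  have aD: "a \<in> D" using xy unfolding D_def a_def by blast
  have anD: "a \<notin> interior D"
  proof
    assume "a \<in> interior D"
    moreover have "interior D \<subseteq> interior (cball 0 (norm a))" using diam' by (intro interior_mono) auto
    ultimately show False by auto
  qed
  have only: "w = x" if "w \<in> tr 0" "w \<in> tr a" for w
  proof -
    have "w \<in> K" "w - a \<in> K" using that by (auto simp: tr_def)
    then have "w - y \<in> D" "w - a - x \<in> D" using xy unfolding D_def by blast+
    then have "norm (w - x + a) \<le> norm a" "norm (w - x - a) \<le> norm a"
      using diam'[of "w - y"] diam'[of "w - a - x"] by (simp_all add: a_def algebra_simps)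
    then have "(norm (w - x + a))\<^sup>2 + (norm (w - x - a))\<^sup>2 \<le> 2 * (norm a)\<^sup>2"
      by (smt (verit) norm_ge_zero power_mono)
    then have "2 * (norm (w - x))\<^sup>2 \<le> 0"
      by (simp add: power2_norm_eq_inner inner_add_left inner_add_right inner_diff_left inner_diff_right inner_commute)
    then show ?thesis by simp
  qed
  define n :: "real^2" where "n = vector [- (a $ 2), a $ 1]"
  have n: "inner n a = 0" "n \<noteq> 0"
    using \<open>a \<noteq> 0\<close> by (auto simp: n_def inner_vec_def sum_2 vec_eq_iff forall_2 vector_2)
  define D' where "D' = (\<lambda>w. w + a) ` D"
  have D'eq: "D' = (+) a ` D" by (simp add: D'_def add.commute)
  have D': "compact D'" "convex D'"
    unfolding D'eq using compact_translation[OF D(1)] convex_translation[OF D(2)] by blast+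
  have D'iff: "w \<in> D' \<longleftrightarrow> w - a \<in> D" for w
    unfolding D'_def by (metis (no_types, lifting) add_diff_cancel_right' diff_add_cancel image_iff)
  have D'int: "w \<in> interior D' \<longleftrightarrow> w - a \<in> interior D" for w
    unfolding D'eq interior_translation
    by (metis (no_types, lifting) add.commute add_diff_cancel_right' diff_add_cancel image_iff)
  obtain k where k: "k \<in> interior K" using Kc(3) by blast
  have zero: "0 \<in> interior D" using intD[OF k, of k] k interior_subset by auto
  have aD': "a \<in> D'" using zero interior_subset by (auto simp: D'iff)
  have "\<exists>t\<in>D \<inter> D'. \<forall>w\<in>D \<inter> D'. inner n w \<le> inner n t"
    using D(1) D'(1) aD aD' by (intro continuous_attains_sup compact_Int continuous_intros) auto
  then obtain t where t: "t \<in> D" "t \<in> D'" and tmax: "\<And>w. w \<in> D \<inter> D' \<Longrightarrow> inner n w \<le> inner n t"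
    by blast
  have ta: "inner n (t - a) = inner n t" using n by (simp add: inner_diff_right)
  have tnD: "t \<notin> interior D"
  proof
    assume ti: "t \<in> interior D"
    have "inner n w \<le> inner n t" if "w \<in> D" for w
      using maximum_beyond_interior[of D' t D n "w + a"] ti t tmax D'(2) that n
      by (auto simp: D'iff inner_add_right)
    then show False using interior_not_maximum[OF ti n(2)] by force
  qed
  have tnD': "t - a \<notin> interior D"
  proof
    assume ti: "t - a \<in> interior D"
    have "inner n w \<le> inner n t" if "w \<in> D" for w
      using maximum_beyond_interior[of D t D' n w] ti t tmax D(2) that by (auto simp: D'int)
    then show False using interior_not_maximum[OF ti n(2)] ta by force
  qed
  define s where "s = a - t"
  have sD: "s \<in> D" "s \<notin> interior D" using Dm[of "t - a"] intDm[of "s"] t tnD' by (auto simp: s_def D'iff)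
  have saD: "s - a \<in> D" "s - a \<notin> interior D" using Dm[of t] intDm[of "- t"] t tnD by (auto simp: s_def)
  have "t - s \<notin> interior D"
  proof
    assume "t - s \<in> interior D"
    then have "a - (1/2) *\<^sub>R (a - (t - s)) \<in> interior D"
      using aD D(2) by (intro mem_interior_convex_shrink) auto
    moreover have "a - (1/2) *\<^sub>R (a - (t - s)) = t"
      by (simp add: s_def vec_eq_iff field_simps)
    ultimately show False using tnD by simp
  qed
  note ts = disjoint[OF this]
  have T: "touch (tr 0) (tr a)" "touch (tr 0) (tr t)" "touch (tr 0) (tr s)" "touch (tr a) (tr t)" "touch (tr a) (tr s)"
    using tt[of a 0, THEN touch_sym] tt[of t 0, THEN touch_sym] tt[of s 0, THEN touch_sym]
      tt[of t a, THEN touch_sym] tt[of s a, THEN touch_sym] aD anD t tnD tnD' sD saD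
    by (simp_all add: D'iff)
  have ext: ?thesis if "tr 0 \<inter> tr a \<inter> tr r = {}" "touch (tr 0) (tr r)" "touch (tr a) (tr r)" for r
    by (rule touching_triple_extends[OF K, of "\<lambda>i. tr ([0, a, r] ! i)"])
      (use that T(1) in \<open>simp_all add: hom\<close>)
  show ?thesis
  proof (cases "tr 0 \<inter> tr a \<inter> tr t = {} \<or> tr 0 \<inter> tr a \<inter> tr s = {}")
    case True
    then show ?thesis using ext T by blast
  next
    case False
    then have "x \<in> tr t" "x \<in> tr s" using only by blast+
    then have T': "touch (tr t) (tr s)" using ts by (auto simp: touch_def)
    have "touching_homothetic_family K ((\<lambda>i. tr ([0, a, t, s] ! i)) ` {..<4}) \<and>
      card ((\<lambda>i. tr ([0, a, t, s] ! i)) ` {..<4}) = 4"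
    proof (rule touching_family_of_sequence[OF K])
      fix i j :: nat assume "i < j" "j < 4"
      then have "(i = 0 \<and> j = 1) \<or> (i = 0 \<and> j = 2) \<or> (i = 0 \<and> j = 3) \<or>
        (i = 1 \<and> j = 2) \<or> (i = 1 \<and> j = 3) \<or> (i = 2 \<and> j = 3)" by linarith
      then show "touch (tr ([0, a, t, s] ! i)) (tr ([0, a, t, s] ! j))"
        by (elim disjE) (simp_all add: T T')
    qed (rule hom)
    then show ?thesis by blast
  qed
qed

section \<open>Parity of crossings\<close>

text \<open>Twice the signed area of the triangle \<open>a b c\<close>.\<close>

definition orient :: "real^2 \<Rightarrow> real^2 \<Rightarrow> real^2 \<Rightarrow> real" where
  "orient a b c = (b$1 - a$1) * (c$2 - a$2) - (b$2 - a$2) * (c$1 - a$1)"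

definition ccw :: "real^2 \<Rightarrow> real^2 \<Rightarrow> real^2 \<Rightarrow> bool" where
  "ccw a b c \<longleftrightarrow> orient a b c > 0"

definition crossing :: "real^2 \<Rightarrow> real^2 \<Rightarrow> real^2 \<Rightarrow> real^2 \<Rightarrow> bool" where
  "crossing a b c d \<longleftrightarrow> ccw a b c \<noteq> ccw a b d \<and> ccw c d a \<noteq> ccw c d b"

definition in_triangle :: "real^2 \<Rightarrow> real^2 \<Rightarrow> real^2 \<Rightarrow> real^2 \<Rightarrow> bool" where
  "in_triangle a b c d \<longleftrightarrow> ccw a b d = ccw b c d \<and> ccw b c d = ccw c a d"

definition general_position :: "(real^2) set \<Rightarrow> bool" where
  "general_position S \<longleftrightarrow>
     (\<forall>a\<in>S. \<forall>b\<in>S. \<forall>c\<in>S. distinct [a, b, c] \<longrightarrow> orient a b c \<noteq> 0)"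

lemma general_position_subset: "general_position S \<Longrightarrow> T \<subseteq> S \<Longrightarrow> general_position T"
  unfolding general_position_def by blast

lemma orient_swap: "orient b a c = - orient a b c" "orient a c b = - orient a b c"
  by (simp_all add: orient_def algebra_simps)

lemma ccw_swap:
  assumes "general_position S" "a \<in> S" "b \<in> S" "c \<in> S" "distinct [a, b, c]"
  shows "ccw b a c \<longleftrightarrow> \<not> ccw a b c" "ccw a c b \<longleftrightarrow> \<not> ccw a b c" "ccw c b a \<longleftrightarrow> \<not> ccw a b c"
    "ccw b c a \<longleftrightarrow> ccw a b c" "ccw c a b \<longleftrightarrow> ccw a b c"
proof -
  have "orient a b c \<noteq> 0" using assms unfolding general_position_def by blast
  then show "ccw b a c \<longleftrightarrow> \<not> ccw a b c" "ccw a c b \<longleftrightarrow> \<not> ccw a b c" "ccw c b a \<longleftrightarrow> \<not> ccw a b c"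
    "ccw b c a \<longleftrightarrow> ccw a b c" "ccw c a b \<longleftrightarrow> ccw a b c"
    using orient_swap[of a b c] orient_swap[of a c b] orient_swap[of b a c] orient_swap[of b c a] orient_swap[of c a b]
    unfolding ccw_def by linarith+
qed

lemma ccw_four_points:
  assumes "general_position S" "a \<in> S" "b \<in> S" "c \<in> S" "d \<in> S" "distinct [a, b, c, d]"
  shows "\<not> (ccw a b c \<and> ccw a c d \<and> \<not> ccw a b d \<and> \<not> ccw b c d)"
    "\<not> (\<not> ccw a b c \<and> \<not> ccw a c d \<and> ccw a b d \<and> ccw b c d)"
proof -
  have "orient a b c + orient a c d = orient a b d + orient b c d"
    by (simp add: orient_def algebra_simps)
  moreover have "orient a b c \<noteq> 0" "orient a b d \<noteq> 0" using assms unfolding general_position_def by auto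
  ultimately show "\<not> (ccw a b c \<and> ccw a c d \<and> \<not> ccw a b d \<and> \<not> ccw b c d)"
    "\<not> (\<not> ccw a b c \<and> \<not> ccw a c d \<and> ccw a b d \<and> ccw b c d)"
    unfolding ccw_def by linarith+
qed

text \<open>The signs in the Grassmann--Pluecker relation for the directions from \<open>a\<close> to the other points.\<close>

lemma ccw_five_points:
  assumes "general_position S" "a \<in> S" "b \<in> S" "c \<in> S" "d \<in> S" "e \<in> S" "distinct [a, b, c, d, e]"
  shows "\<not> ((ccw a b c = ccw a d e) \<and> (ccw a b d \<noteq> ccw a c e) \<and> (ccw a b e = ccw a c d))"
    "\<not> ((ccw a b c \<noteq> ccw a d e) \<and> (ccw a b d = ccw a c e) \<and> (ccw a b e \<noteq> ccw a c d))"
proof -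
  have rel: "orient a b c * orient a d e - orient a b d * orient a c e + orient a b e * orient a c d = 0"
    by (simp add: orient_def algebra_simps)
  have nz: "orient a b c \<noteq> 0" "orient a d e \<noteq> 0" "orient a b d \<noteq> 0" "orient a c e \<noteq> 0"
    "orient a b e \<noteq> 0" "orient a c d \<noteq> 0"
    using assms unfolding general_position_def by auto
  have s: "(x > 0) = (y > 0) \<longleftrightarrow> x * y > 0" "(x > 0) \<noteq> (y > 0) \<longleftrightarrow> x * y < 0"
    if "x \<noteq> 0" "y \<noteq> 0" for x y :: real
    using that by (auto simp: zero_less_mult_iff mult_less_0_iff)
  show "\<not> ((ccw a b c = ccw a d e) \<and> (ccw a b d \<noteq> ccw a c e) \<and> (ccw a b e = ccw a c d))"
    "\<not> ((ccw a b c \<noteq> ccw a d e) \<and> (ccw a b d = ccw a c e) \<and> (ccw a b e \<noteq> ccw a c d))"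
    unfolding ccw_def s(1)[OF nz(1,2)] s(2)[OF nz(1,2)] s(1)[OF nz(3,4)] s(2)[OF nz(3,4)]
      s(1)[OF nz(5,6)] s(2)[OF nz(5,6)]
    using rel by linarith+
qed

lemma crossing_segments_meet:
  assumes "general_position {a, b, c, d}" "distinct [a, b, c, d]" "crossing a b c d"
  shows "closed_segment a b \<inter> closed_segment c d \<noteq> {}"
proof -
  have nz: "orient a b c \<noteq> 0" "orient a b d \<noteq> 0" "orient c d a \<noteq> 0" "orient c d b \<noteq> 0"
    using assms(1,2) unfolding general_position_def by auto
  define D where "D = orient a b c - orient a b d"
  have E: "orient c d a - orient c d b = - D" by (simp add: D_def orient_def algebra_simps)
  define s t where "s = orient a b c / D" and "t = - orient c d a / D"
  have D0: "D \<noteq> 0" using assms(3) nz by (auto simp: crossing_def ccw_def D_def)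
  have "0 \<le> s \<and> s \<le> 1"
    using assms(3) nz unfolding s_def D_def crossing_def ccw_def by (auto simp: field_simps)
  moreover have "t = orient c d a / (orient c d a - orient c d b)" unfolding E t_def by simp
  then have "0 \<le> t \<and> t \<le> 1"
    using assms(3) nz unfolding crossing_def ccw_def by (auto simp: field_simps)
  moreover have "(1 - s) *\<^sub>R c + s *\<^sub>R d = (1 - t) *\<^sub>R a + t *\<^sub>R b"
  proof -
    have "D *\<^sub>R ((1 - s) *\<^sub>R c + s *\<^sub>R d) = (D - orient a b c) *\<^sub>R c + orient a b c *\<^sub>R d"
      "D *\<^sub>R ((1 - t) *\<^sub>R a + t *\<^sub>R b) = (D + orient c d a) *\<^sub>R a - orient c d a *\<^sub>R b"
      using D0 by (simp_all add: s_def t_def scaleR_add_right scaleR_diff_right distrib_left right_diff_distrib)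
    moreover have "(D - orient a b c) *\<^sub>R c + orient a b c *\<^sub>R d = (D + orient c d a) *\<^sub>R a - orient c d a *\<^sub>R b"
      unfolding vec_eq_iff forall_2 D_def orient_def by (simp add: algebra_simps)
    ultimately have "D *\<^sub>R ((1 - s) *\<^sub>R c + s *\<^sub>R d) = D *\<^sub>R ((1 - t) *\<^sub>R a + t *\<^sub>R b)" by simp
    then show ?thesis using D0 by simp
  qed
  ultimately show ?thesis by (auto simp: closed_segment_def)
qed

text \<open>Four points in general position span a crossing iff their Radon partition is two against two.
  The relation \<open>[abc] - [abd] + [acd] - [bcd] = 0\<close> shows the signs of that partition.\<close>

lemma even_crossings_four_points:
  assumes "general_position S" "a \<in> S" "b \<in> S" "c \<in> S" "d \<in> S" "distinct [a, b, c, d]"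
  shows "even (of_bool (crossing a b c d) + of_bool (crossing a c b d) + of_bool (crossing a d b c) + 1
    + of_bool (ccw a b c) + of_bool (ccw a b d) + of_bool (ccw a c d) + of_bool (ccw b c d) :: nat)"
proof -
  have s: "x \<in> S \<Longrightarrow> y \<in> S \<Longrightarrow> z \<in> S \<Longrightarrow> distinct [x, y, z] \<Longrightarrow> ccw y x z \<longleftrightarrow> \<not> ccw x y z" 
    "x \<in> S \<Longrightarrow> y \<in> S \<Longrightarrow> z \<in> S \<Longrightarrow> distinct [x, y, z] \<Longrightarrow> ccw y z x \<longleftrightarrow> ccw x y z"
    "x \<in> S \<Longrightarrow> y \<in> S \<Longrightarrow> z \<in> S \<Longrightarrow> distinct [x, y, z] \<Longrightarrow> ccw x z y \<longleftrightarrow> \<not> ccw x y z" for x y z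
    using ccw_swap[OF assms(1)] by blast+
  have "ccw c d a = ccw a c d" "ccw c d b = ccw b c d" "ccw a c b = (\<not> ccw a b c)"
    "ccw b d a = ccw a b d" "ccw b d c = (\<not> ccw b c d)" "ccw a d b = (\<not> ccw a b d)"
    "ccw a d c = (\<not> ccw a c d)" "ccw b c a = ccw a b c"
    using s[of a c d] s[of b c d] s[of a b c] s[of a b d] assms by auto
  then show ?thesis
    using ccw_four_points[OF assms] unfolding crossing_def
    by (cases "ccw a b c"; cases "ccw a b d"; cases "ccw a c d"; cases "ccw b c d"; simp)
qed

text \<open>A segment enters or leaves a triangle each time it crosses a side.\<close>

lemma even_crossings_triangle:
  assumes "general_position S" "a \<in> S" "b \<in> S" "c \<in> S" "d \<in> S" "e \<in> S" "distinct [a, b, c, d, e]"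
  shows "even (of_bool (crossing a b d e) + of_bool (crossing b c d e) + of_bool (crossing c a d e)
    + of_bool (in_triangle a b c d) + of_bool (in_triangle a b c e) :: nat)"
proof -
  have d3: "distinct [a, b, c]" "distinct [a, b, d]" "distinct [a, b, e]" "distinct [a, c, d]" "distinct [a, c, e]"
    "distinct [a, d, e]" "distinct [b, c, d]" "distinct [b, c, e]" "distinct [b, d, e]" "distinct [c, d, e]"
    and d4: "distinct [a, b, c, d]" "distinct [a, b, c, e]" "distinct [a, b, d, e]" "distinct [a, c, d, e]" "distinct [b, c, d, e]"
    and d5: "distinct [d, a, b, c, e]" "distinct [e, a, b, c, d]"
    using assms(7) by auto
  note sorted = ccw_swap[OF assms(1, 2, 3, 4) d3(1)]
     ccw_swap[OF assms(1, 2, 3, 5) d3(2)]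
     ccw_swap[OF assms(1, 2, 3, 6) d3(3)]
     ccw_swap[OF assms(1, 2, 4, 5) d3(4)]
     ccw_swap[OF assms(1, 2, 4, 6) d3(5)]
     ccw_swap[OF assms(1, 2, 5, 6) d3(6)]
     ccw_swap[OF assms(1, 3, 4, 5) d3(7)]
     ccw_swap[OF assms(1, 3, 4, 6) d3(8)]
     ccw_swap[OF assms(1, 3, 5, 6) d3(9)]
     ccw_swap[OF assms(1, 4, 5, 6) d3(10)]
  note four = ccw_four_points[OF assms(1, 2, 3, 4, 5) d4(1)]
     ccw_four_points[OF assms(1, 2, 3, 4, 6) d4(2)]
     ccw_four_points[OF assms(1, 2, 3, 5, 6) d4(3)]
     ccw_four_points[OF assms(1, 2, 4, 5, 6) d4(4)]
     ccw_four_points[OF assms(1, 3, 4, 5, 6) d4(5)]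
  note five = ccw_five_points[OF assms(1, 5, 2, 3, 4, 6) d5(1)] ccw_five_points[OF assms(1, 6, 2, 3, 4, 5) d5(2)]
  have parity: "even (of_bool p + of_bool q + of_bool r + of_bool t + of_bool u :: nat)
      \<longleftrightarrow> \<not> ((((p = q) = r) = t) = u)" for p q r t u
    by (cases p; cases q; cases r; cases t; cases u; simp)
  show ?thesis
    using four five unfolding parity crossing_def in_triangle_def sorted
    by argo
qed

lemma crossing_commute: "crossing c d a b = crossing a b c d"
  unfolding crossing_def by blast

lemma crossing_swap:
  assumes "general_position S" "a \<in> S" "b \<in> S" "c \<in> S" "d \<in> S" "distinct [a, b, c, d]"
  shows "crossing b a c d = crossing a b c d"
proof -
  have d: "distinct [a, b, c]" "distinct [a, b, d]" using assms(6) by auto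
  show ?thesis
    unfolding crossing_def ccw_swap[OF assms(1-4) d(1)] ccw_swap[OF assms(1-3,5) d(2)] by blast
qed

text \<open>Replacing the segment from \<open>a\<close> to \<open>b\<close> by the path through \<open>m\<close> amounts to adding the boundary
  of the triangle \<open>a b m\<close>, which is crossed by a path from \<open>c\<close> to \<open>d\<close> according to the positions of
  \<open>c\<close> and \<open>d\<close> only; the bend \<open>n\<close> counts twice.\<close>

lemma even_crossings_bent_edges:
  assumes gp: "general_position S"
    and S: "a \<in> S" "b \<in> S" "m \<in> S" "c \<in> S" "d \<in> S" "n \<in> S"
    and dist: "distinct [a, b, m, c, d, n]"
  shows "even (of_bool (crossing a m c n) + of_bool (crossing a m n d) + of_bool (crossing m b c n)
    + of_bool (crossing m b n d) + of_bool (crossing a b c d) + of_bool (in_triangle a b m c)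
    + of_bool (in_triangle a b m d) + of_bool (in_triangle c d n a) + of_bool (in_triangle c d n b) :: nat)"
proof -
  have d5: "distinct [a, b, m, c, n]" "distinct [a, b, m, n, d]" "distinct [c, d, n, a, b]"
    and d4: "distinct [m, b, c, n]" "distinct [a, m, c, n]" "distinct [m, b, n, d]" "distinct [a, m, n, d]"
      "distinct [n, d, a, b]" "distinct [c, n, a, b]"
    using dist by auto
  note swaps = crossing_swap[OF gp S(3,2,4,6) d4(1)] crossing_swap[OF gp S(1,3,4,6) d4(2)]
    crossing_swap[OF gp S(3,2,6,5) d4(3)] crossing_swap[OF gp S(1,3,6,5) d4(4)]
    crossing_swap[OF gp S(6,5,1,2) d4(5)] crossing_swap[OF gp S(4,6,1,2) d4(6)]
  note commutes = crossing_commute[of c d a b] crossing_commute[of n d a b] crossing_commute[of c n a b]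
  have even_of_bool: "even (of_bool p :: nat) \<longleftrightarrow> \<not> p" for p by simp
  show ?thesis
    using even_crossings_triangle[OF gp S(1,2,3,4,6) d5(1)] even_crossings_triangle[OF gp S(1,2,3,6,5) d5(2)]
      even_crossings_triangle[OF gp S(4,5,6,1,2) d5(3)]
    unfolding swaps commutes even_add even_of_bool by argo
qed

text \<open>Summing over the five quadruples counts each of the ten triples twice.\<close>

lemma odd_crossings_straight_complete_graph:
  fixes v :: "nat \<Rightarrow> real^2"
  assumes gp: "general_position S" and v: "\<And>i. i < 5 \<Longrightarrow> v i \<in> S" "inj_on v {..<5}"
  defines "C \<equiv> \<lambda>i j k l. of_bool (crossing (v i) (v j) (v k) (v l)) :: nat"
  shows "odd (C 0 1 2 3 + C 0 2 1 3 + C 0 3 1 2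
      + C 0 1 2 4 + C 0 2 1 4 + C 0 4 1 2
      + C 0 1 3 4 + C 0 3 1 4 + C 0 4 1 3
      + C 0 2 3 4 + C 0 3 2 4 + C 0 4 2 3
      + C 1 2 3 4 + C 1 3 2 4 + C 1 4 2 3)"
proof -
  define G :: "nat \<Rightarrow> nat \<Rightarrow> nat \<Rightarrow> nat" where "G i j k = of_bool (ccw (v i) (v j) (v k))" for i j k
  have four: "even (C i j k l + C i k j l + C i l j k + 1 + G i j k + G i j l + G i k l + G j k l)"
    if "i < j" "j < k" "k < l" "l < 5" for i j k l
  proof -
    have "v i \<noteq> v j" "v i \<noteq> v k" "v i \<noteq> v l" "v j \<noteq> v k" "v j \<noteq> v l" "v k \<noteq> v l"
      using that inj_onD[OF v(2)] by (metis less_trans lessThan_iff nat_neq_iff)+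
    then show ?thesis
      unfolding C_def G_def using that by (intro even_crossings_four_points[OF gp]) (simp_all add: v(1))
  qed
  have "even ((C 0 1 2 3 + C 0 2 1 3 + C 0 3 1 2 + 1 + G 0 1 2 + G 0 1 3 + G 0 2 3 + G 1 2 3)
      + (C 0 1 2 4 + C 0 2 1 4 + C 0 4 1 2 + 1 + G 0 1 2 + G 0 1 4 + G 0 2 4 + G 1 2 4)
      + (C 0 1 3 4 + C 0 3 1 4 + C 0 4 1 3 + 1 + G 0 1 3 + G 0 1 4 + G 0 3 4 + G 1 3 4)
      + (C 0 2 3 4 + C 0 3 2 4 + C 0 4 2 3 + 1 + G 0 2 3 + G 0 2 4 + G 0 3 4 + G 2 3 4)
      + (C 1 2 3 4 + C 1 3 2 4 + C 1 4 2 3 + 1 + G 1 2 3 + G 1 2 4 + G 1 3 4 + G 2 3 4))"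
    by (intro four dvd_add) simp_all
  also have "(C 0 1 2 3 + C 0 2 1 3 + C 0 3 1 2 + 1 + G 0 1 2 + G 0 1 3 + G 0 2 3 + G 1 2 3)
      + (C 0 1 2 4 + C 0 2 1 4 + C 0 4 1 2 + 1 + G 0 1 2 + G 0 1 4 + G 0 2 4 + G 1 2 4)
      + (C 0 1 3 4 + C 0 3 1 4 + C 0 4 1 3 + 1 + G 0 1 3 + G 0 1 4 + G 0 3 4 + G 1 3 4)
      + (C 0 2 3 4 + C 0 3 2 4 + C 0 4 2 3 + 1 + G 0 2 3 + G 0 2 4 + G 0 3 4 + G 2 3 4)
      + (C 1 2 3 4 + C 1 3 2 4 + C 1 4 2 3 + 1 + G 1 2 3 + G 1 2 4 + G 1 3 4 + G 2 3 4)
    = (C 0 1 2 3 + C 0 2 1 3 + C 0 3 1 2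
      + C 0 1 2 4 + C 0 2 1 4 + C 0 4 1 2
      + C 0 1 3 4 + C 0 3 1 4 + C 0 4 1 3
      + C 0 2 3 4 + C 0 3 2 4 + C 0 4 2 3
      + C 1 2 3 4 + C 1 3 2 4 + C 1 4 2 3) + 5 + 2 * (G 0 1 2 + G 0 1 3 + G 0 1 4 + G 0 2 3 + G 0 2 4 + G 0 3 4 + G 1 2 3 + G 1 2 4 + G 1 3 4 + G
      2 3 4)"
    by simp
  finally show ?thesis by simp
qed

text \<open>Each containment \<open>v k \<in> triangle (v i) (v j) (m i j)\<close> occurs for two of the edges at \<open>v k\<close>, so
  bending the edges does not change the parity of the number of crossings.\<close>

lemma crossing_bent_complete_graph_general:
  fixes v :: "nat \<Rightarrow> real^2" and m :: "nat \<Rightarrow> nat \<Rightarrow> real^2"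
  assumes gp: "general_position S"
    and S: "\<And>i. i < 5 \<Longrightarrow> v i \<in> S" "\<And>i j. i < 5 \<Longrightarrow> j < 5 \<Longrightarrow> i \<noteq> j \<Longrightarrow> m i j \<in> S"
    and v: "inj_on v {..<5}"
    and vm: "\<And>i j k. i < 5 \<Longrightarrow> j < 5 \<Longrightarrow> k < 5 \<Longrightarrow> i \<noteq> j \<Longrightarrow> v k \<noteq> m i j"
    and mm: "\<And>i j k l. i < 5 \<Longrightarrow> j < 5 \<Longrightarrow> k < 5 \<Longrightarrow> l < 5 \<Longrightarrow> i \<noteq> j \<Longrightarrow> k \<noteq> l \<Longrightarrow> i \<noteq> k \<Longrightarrow> m i j \<noteq> m k l"
  shows "\<exists>i j k l. i < 5 \<and> j < 5 \<and> k < 5 \<and> l < 5 \<and> distinct [i, j, k, l] \<and>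
    (crossing (v i) (m i j) (v k) (m k l) \<or> crossing (v i) (m i j) (m k l) (v l) \<or>
     crossing (m i j) (v j) (v k) (m k l) \<or> crossing (m i j) (v j) (m k l) (v l))"
proof (rule ccontr)
  assume none: "\<not> ?thesis"
  define C :: "nat \<Rightarrow> nat \<Rightarrow> nat \<Rightarrow> nat \<Rightarrow> nat" where
    "C i j k l = of_bool (crossing (v i) (v j) (v k) (v l))" for i j k l
  define J :: "nat \<Rightarrow> nat \<Rightarrow> nat \<Rightarrow> nat" where
    "J i j k = of_bool (in_triangle (v i) (v j) (m i j) (v k))" for i j k
  have two: "even (C i j k l + J i j k + J i j l + J k l i + J k l j)"
    if lt: "i < 5" "j < 5" "k < 5" "l < 5" and d: "distinct [i, j, k, l]" for i j k l
  proof -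
    have "v i \<noteq> v j" "v i \<noteq> v k" "v i \<noteq> v l" "v j \<noteq> v k" "v j \<noteq> v l" "v k \<noteq> v l"
      using lt d inj_onD[OF v] by (auto dest: inj_onD[OF v])
    moreover have "i \<noteq> j" "k \<noteq> l" "i \<noteq> k" using d by auto
    ultimately have "distinct [v i, v j, m i j, v k, v l, m k l]"
      using vm[of i j] vm[of k l] mm[of i j k l] lt by (auto dest: sym)
    then have "even (of_bool (crossing (v i) (m i j) (v k) (m k l)) + of_bool (crossing (v i) (m i j) (m k l) (v l))
      + of_bool (crossing (m i j) (v j) (v k) (m k l)) + of_bool (crossing (m i j) (v j) (m k l) (v l))
      + of_bool (crossing (v i) (v j) (v k) (v l)) + of_bool (in_triangle (v i) (v j) (m i j) (v k))
      + of_bool (in_triangle (v i) (v j) (m i j) (v l)) + of_bool (in_triangle (v k) (v l) (m k l) (v i))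
      + of_bool (in_triangle (v k) (v l) (m k l) (v j)) :: nat)"
      using lt \<open>i \<noteq> j\<close> \<open>k \<noteq> l\<close> S by (intro even_crossings_bent_edges[OF gp]) simp_all
    moreover have "\<not> crossing (v i) (m i j) (v k) (m k l)" "\<not> crossing (v i) (m i j) (m k l) (v l)"
      "\<not> crossing (m i j) (v j) (v k) (m k l)" "\<not> crossing (m i j) (v j) (m k l) (v l)"
      using none lt d by blast+
    ultimately show ?thesis by (simp add: C_def J_def)
  qed
  have "even ((C 0 1 2 3 + J 0 1 2 + J 0 1 3 + J 2 3 0 + J 2 3 1)
      + (C 0 2 1 3 + J 0 2 1 + J 0 2 3 + J 1 3 0 + J 1 3 2)
      + (C 0 3 1 2 + J 0 3 1 + J 0 3 2 + J 1 2 0 + J 1 2 3)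
      + (C 0 1 2 4 + J 0 1 2 + J 0 1 4 + J 2 4 0 + J 2 4 1)
      + (C 0 2 1 4 + J 0 2 1 + J 0 2 4 + J 1 4 0 + J 1 4 2)
      + (C 0 4 1 2 + J 0 4 1 + J 0 4 2 + J 1 2 0 + J 1 2 4)
      + (C 0 1 3 4 + J 0 1 3 + J 0 1 4 + J 3 4 0 + J 3 4 1)
      + (C 0 3 1 4 + J 0 3 1 + J 0 3 4 + J 1 4 0 + J 1 4 3)
      + (C 0 4 1 3 + J 0 4 1 + J 0 4 3 + J 1 3 0 + J 1 3 4)
      + (C 0 2 3 4 + J 0 2 3 + J 0 2 4 + J 3 4 0 + J 3 4 2)
      + (C 0 3 2 4 + J 0 3 2 + J 0 3 4 + J 2 4 0 + J 2 4 3)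
      + (C 0 4 2 3 + J 0 4 2 + J 0 4 3 + J 2 3 0 + J 2 3 4)
      + (C 1 2 3 4 + J 1 2 3 + J 1 2 4 + J 3 4 1 + J 3 4 2)
      + (C 1 3 2 4 + J 1 3 2 + J 1 3 4 + J 2 4 1 + J 2 4 3)
      + (C 1 4 2 3 + J 1 4 2 + J 1 4 3 + J 2 3 1 + J 2 3 4))"
    by (intro two dvd_add) simp_all
  also have "(C 0 1 2 3 + J 0 1 2 + J 0 1 3 + J 2 3 0 + J 2 3 1)
      + (C 0 2 1 3 + J 0 2 1 + J 0 2 3 + J 1 3 0 + J 1 3 2)
      + (C 0 3 1 2 + J 0 3 1 + J 0 3 2 + J 1 2 0 + J 1 2 3)
      + (C 0 1 2 4 + J 0 1 2 + J 0 1 4 + J 2 4 0 + J 2 4 1)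
      + (C 0 2 1 4 + J 0 2 1 + J 0 2 4 + J 1 4 0 + J 1 4 2)
      + (C 0 4 1 2 + J 0 4 1 + J 0 4 2 + J 1 2 0 + J 1 2 4)
      + (C 0 1 3 4 + J 0 1 3 + J 0 1 4 + J 3 4 0 + J 3 4 1)
      + (C 0 3 1 4 + J 0 3 1 + J 0 3 4 + J 1 4 0 + J 1 4 3)
      + (C 0 4 1 3 + J 0 4 1 + J 0 4 3 + J 1 3 0 + J 1 3 4)
      + (C 0 2 3 4 + J 0 2 3 + J 0 2 4 + J 3 4 0 + J 3 4 2)
      + (C 0 3 2 4 + J 0 3 2 + J 0 3 4 + J 2 4 0 + J 2 4 3)
      + (C 0 4 2 3 + J 0 4 2 + J 0 4 3 + J 2 3 0 + J 2 3 4)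
      + (C 1 2 3 4 + J 1 2 3 + J 1 2 4 + J 3 4 1 + J 3 4 2)
      + (C 1 3 2 4 + J 1 3 2 + J 1 3 4 + J 2 4 1 + J 2 4 3)
      + (C 1 4 2 3 + J 1 4 2 + J 1 4 3 + J 2 3 1 + J 2 3 4)
    = (C 0 1 2 3 + C 0 2 1 3 + C 0 3 1 2
      + C 0 1 2 4 + C 0 2 1 4 + C 0 4 1 2
      + C 0 1 3 4 + C 0 3 1 4 + C 0 4 1 3
      + C 0 2 3 4 + C 0 3 2 4 + C 0 4 2 3
      + C 1 2 3 4 + C 1 3 2 4 + C 1 4 2 3) + 2 * (J 0 1 2 + J 0 1 3 + J 2 3 0 + J 2 3 1 + J 0 2 1 + J 0 2 3 + J 1 3 0 + J 1 3 2 + J 0 3 1 + J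
      0 3 2 + J 1 2 0 + J 1 2 3 + J 0 1 4 + J 2 4 0 + J 2 4 1 + J 0 2 4 + J 1 4 0 + J 1 4 2 + J 0
      4 1 + J 0 4 2 + J 1 2 4 + J 3 4 0 + J 3 4 1 + J 0 3 4 + J 1 4 3 + J 0 4 3 + J 1 3 4 + J 3 4
      2 + J 2 4 3 + J 2 3 4)"
    by simp
  finally have "even (C 0 1 2 3 + C 0 2 1 3 + C 0 3 1 2
      + C 0 1 2 4 + C 0 2 1 4 + C 0 4 1 2
      + C 0 1 3 4 + C 0 3 1 4 + C 0 4 1 3
      + C 0 2 3 4 + C 0 3 2 4 + C 0 4 2 3
      + C 1 2 3 4 + C 1 3 2 4 + C 1 4 2 3)" by simp
  moreover have "odd (C 0 1 2 3 + C 0 2 1 3 + C 0 3 1 2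
      + C 0 1 2 4 + C 0 2 1 4 + C 0 4 1 2
      + C 0 1 3 4 + C 0 3 1 4 + C 0 4 1 3
      + C 0 2 3 4 + C 0 3 2 4 + C 0 4 2 3
      + C 1 2 3 4 + C 1 3 2 4 + C 1 4 2 3)"
    unfolding C_def by (rule odd_crossings_straight_complete_graph[OF gp S(1) v])
  ultimately show False by simp
qed

section \<open>Perturbation to general position\<close>

lemma negligible_line: 
  assumes "a \<noteq> b"
  shows "negligible {x. orient a b x = 0}"
proof -
  define n :: "real^2" where "n = vector [- (b$2 - a$2), b$1 - a$1]"
  have "n \<noteq> 0" using assms by (auto simp: n_def vec_eq_iff forall_2)
  moreover have "{x. orient a b x = 0} = {x. inner n x = inner n a}"
    by (auto simp: orient_def n_def inner_vec_def sum_2 algebra_simps)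
  ultimately show ?thesis by (simp add: negligible_hyperplane)
qed

text \<open>One point after the other can be moved off the finitely many lines through the earlier ones, as
  these form a null set.\<close>

lemma perturb_to_general_position:
  fixes P :: "'i \<Rightarrow> real^2"
  assumes "finite I" "e > 0"
  shows "\<exists>Q. inj_on Q I \<and> general_position (Q ` I) \<and> (\<forall>i\<in>I. dist (P i) (Q i) < e)"
  using assms(1)
proof (induction I rule: finite_induct)
  case empty
  then show ?case by (auto simp: general_position_def)
next
  case (insert i I)
  then obtain Q where Q: "inj_on Q I" "general_position (Q ` I)" "\<forall>i\<in>I. dist (P i) (Q i) < e" by blast
  define N where "N = Q ` I \<union> (\<Union>(a, b)\<in>{(a, b) \<in> Q ` I \<times> Q ` I. a \<noteq> b}. {x. orient a b x = 0})"
  have "finite {(a, b) \<in> Q ` I \<times> Q ` I. a \<noteq> b}"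
    by (rule finite_subset[of _ "Q ` I \<times> Q ` I"]) (use insert.hyps(1) in auto)
  then have "negligible N"
    unfolding N_def using insert.hyps(1)
    by (intro negligible_Un negligible_finite[of "Q ` I"] negligible_Union) (auto intro: negligible_line)
  then have "\<not> ball (P i) e \<subseteq> N"
    using assms(2) open_not_negligible[of "ball (P i) e"] negligible_subset by auto
  then obtain q where "q \<in> ball (P i) e" "q \<notin> N" by blast
  then have q: "dist (P i) q < e" "q \<notin> N" by simp_all
  have "q \<notin> Q ` I" using q(2) by (auto simp: N_def)
  moreover have line: "orient a b q \<noteq> 0" if "a \<in> Q ` I" "b \<in> Q ` I" "a \<noteq> b" for a b
    using q(2) that by (auto simp: N_def)
  have "general_position (insert q (Q ` I))"
    unfolding general_position_def
  proof (intro ballI impI)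
    fix a b c assume abc: "a \<in> insert q (Q ` I)" "b \<in> insert q (Q ` I)" "c \<in> insert q (Q ` I)" "distinct [a, b, c]"
    show "orient a b c \<noteq> 0"
    proof (cases "c = q")
      case True
      then show ?thesis using abc line by auto
    next
      case c: False
      show ?thesis
      proof (cases "b = q")
        case True
        then show ?thesis using abc line[of a c] c orient_swap(2)[of a c q] by auto
      next
        case b: False
        then show ?thesis
          using abc line[of b c] c orient_swap(2)[of b c q] orient_swap(1)[of b q c] Q(2)
          by (cases "a = q") (auto simp: general_position_def)
      qed
    qed
  qed
  moreover have "Q(i := q) ` insert i I = insert q (Q ` I)" using insert.hyps(2) by auto
  ultimately have "inj_on (Q(i := q)) (insert i I) \<and> general_position (Q(i := q) ` insert i I) \<and>
      (\<forall>j\<in>insert i I. dist (P j) ((Q(i := q)) j) < e)"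
    using Q insert.hyps(2) q(1) by (auto simp: inj_on_fun_updI)
  then show ?case by blast
qed

lemma disjoint_segments_stable:
  fixes a b c d :: "real^2"
  assumes "closed_segment a b \<inter> closed_segment c d = {}"
  shows "eventually (\<lambda>e. \<forall>a' b' c' d'. dist a a' < e \<longrightarrow> dist b b' < e \<longrightarrow> dist c c' < e \<longrightarrow> dist d d' < e \<longrightarrow>
    closed_segment a' b' \<inter> closed_segment c' d' = {}) (at_right 0)"
proof -
  obtain g where g: "g > 0" "\<And>x y. x \<in> closed_segment a b \<Longrightarrow> y \<in> closed_segment c d \<Longrightarrow> g \<le> dist x y"
    using separate_compact_closed[OF compact_segment closed_segment assms] by blast
  have near: "\<exists>z\<in>closed_segment p q. dist z x < e"
    if pq: "dist p p' < e" "dist q q' < e" and x: "x \<in> closed_segment p' q'" for p q p' q' x :: "real^2" and e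
  proof -
    obtain u where u: "0 \<le> u" "u \<le> 1" "x = (1 - u) *\<^sub>R p' + u *\<^sub>R q'"
      using x by (auto simp: closed_segment_def)
    have "((1 - u) *\<^sub>R p + u *\<^sub>R q) - x = (1 - u) *\<^sub>R (p - p') + u *\<^sub>R (q - q')"
      unfolding u(3) by (simp add: algebra_simps)
    then have "dist ((1 - u) *\<^sub>R p + u *\<^sub>R q) x \<le> (1 - u) * dist p p' + u * dist q q'"
      using u(1,2) norm_triangle_ineq[of "(1 - u) *\<^sub>R (p - p')" "u *\<^sub>R (q - q')"] by (simp add: dist_norm)
    also have "\<dots> < e"
      using u(1,2) pq by (intro convex_bound_lt) auto
    finally show ?thesis using u(1,2) by (auto simp: closed_segment_def)
  qed
  have "closed_segment a' b' \<inter> closed_segment c' d' = {}"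
    if e: "e < g / 2" and d: "dist a a' < e" "dist b b' < e" "dist c c' < e" "dist d d' < e" for e a' b' c' d'
  proof -
    have False if x: "x \<in> closed_segment a' b'" "x \<in> closed_segment c' d'" for x
    proof -
      obtain y z where "y \<in> closed_segment a b" "dist y x < e" "z \<in> closed_segment c d" "dist z x < e"
        using near[OF d(1,2) x(1)] near[OF d(3,4) x(2)] by blast
      then show False using g(2)[of y z] e dist_triangle2[of y z x] by linarith
    qed
    then show ?thesis by blast
  qed
  moreover have "eventually (\<lambda>e. e < g / 2) (at_right (0::real))"
    using g(1) by (intro eventually_at_rightI[of 0 "g / 2"]) auto
  ultimately show ?thesis by (rule_tac eventually_mono) blast+
qed

text \<open>The complete graph on five vertices is not planar, for drawings in which each edge
  \<open>{i, j}\<close> is bent once, at \<open>m i j\<close>: disjoint edges stay disjoint under a small perturbation to general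
  position.\<close>

lemma crossing_bent_complete_graph:
  fixes v :: "nat \<Rightarrow> real^2" and m :: "nat \<Rightarrow> nat \<Rightarrow> real^2"
  defines "E \<equiv> \<lambda>i j. closed_segment (v i) (m i j) \<union> closed_segment (m i j) (v j)"
  shows "\<exists>i j k l. i < 5 \<and> j < 5 \<and> k < 5 \<and> l < 5 \<and> distinct [i, j, k, l] \<and> E i j \<inter> E k l \<noteq> {}"
proof (rule ccontr)
  assume none: "\<not> ?thesis"
  define P where "P = (\<lambda>(i, j). if i = j then v i else m i j)"
  define I where "I = {..<5::nat} \<times> {..<5::nat}"
  have I: "finite I" by (simp add: I_def)
  define good where "good e x y z w \<longleftrightarrow> (\<forall>a b c d. dist (P x) a < e \<longrightarrow> dist (P y) b < e \<longrightarrow>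
    dist (P z) c < e \<longrightarrow> dist (P w) d < e \<longrightarrow> closed_segment a b \<inter> closed_segment c d = {})" for e x y z w
  have "eventually (\<lambda>e. \<forall>x\<in>I. \<forall>y\<in>I. \<forall>z\<in>I. \<forall>w\<in>I.
      closed_segment (P x) (P y) \<inter> closed_segment (P z) (P w) = {} \<longrightarrow> good e x y z w) (at_right 0)"
    using I disjoint_segments_stable unfolding good_def
    by (intro eventually_ball_finite ballI) (auto simp: eventually_conj_iff)
  then obtain e where e: "e > 0" and stable: "\<And>x y z w. x \<in> I \<Longrightarrow> y \<in> I \<Longrightarrow> z \<in> I \<Longrightarrow> w \<in> I \<Longrightarrow>
      closed_segment (P x) (P y) \<inter> closed_segment (P z) (P w) = {} \<Longrightarrow> good e x y z w"
    unfolding eventually_at_right_field by (metis dense)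
  obtain Q where Q: "inj_on Q I" "general_position (Q ` I)" "\<And>i. i \<in> I \<Longrightarrow> dist (P i) (Q i) < e"
    using perturb_to_general_position[OF I e, of P] by blast
  have "\<exists>i j k l. i < 5 \<and> j < 5 \<and> k < 5 \<and> l < 5 \<and> distinct [i, j, k, l] \<and>
    (crossing (Q (i, i)) (Q (i, j)) (Q (k, k)) (Q (k, l)) \<or> crossing (Q (i, i)) (Q (i, j)) (Q (k, l)) (Q (l, l)) \<or>
     crossing (Q (i, j)) (Q (j, j)) (Q (k, k)) (Q (k, l)) \<or> crossing (Q (i, j)) (Q (j, j)) (Q (k, l)) (Q (l, l)))"
  proof (rule crossing_bent_complete_graph_general[OF Q(2)])
    show "inj_on (\<lambda>i. Q (i, i)) {..<5}"
      using inj_onD[OF Q(1)] by (auto simp: inj_on_def I_def)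
  qed (auto simp: I_def inj_on_eq_iff[OF Q(1)])
  then obtain i j k l where lt: "i < 5" "j < 5" "k < 5" "l < 5" and d: "distinct [i, j, k, l]"
    and cr: "crossing (Q (i, i)) (Q (i, j)) (Q (k, k)) (Q (k, l)) \<or> crossing (Q (i, i)) (Q (i, j)) (Q (k, l)) (Q (l, l)) \<or>
     crossing (Q (i, j)) (Q (j, j)) (Q (k, k)) (Q (k, l)) \<or> crossing (Q (i, j)) (Q (j, j)) (Q (k, l)) (Q (l, l))"
    by blast
  have no: "\<not> crossing (Q x) (Q y) (Q z) (Q w)"
    if xyzw: "x \<in> I" "y \<in> I" "z \<in> I" "w \<in> I" "distinct [x, y, z, w]"
      and dis: "closed_segment (P x) (P y) \<inter> closed_segment (P z) (P w) = {}" for x y z w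
  proof
    assume cr: "crossing (Q x) (Q y) (Q z) (Q w)"
    have "general_position {Q x, Q y, Q z, Q w}"
      using xyzw by (intro general_position_subset[OF Q(2)]) auto
    moreover have "distinct [Q x, Q y, Q z, Q w]"
      using xyzw by (simp add: inj_on_eq_iff[OF Q(1)])
    ultimately have "closed_segment (Q x) (Q y) \<inter> closed_segment (Q z) (Q w) \<noteq> {}"
      using cr by (rule crossing_segments_meet)
    moreover have "good e x y z w" using stable xyzw(1-4) dis by blast
    ultimately show False unfolding good_def using Q(3) xyzw(1-4) by blast
  qed
  have "E i j \<inter> E k l = {}" using none lt d by blast
  then have "closed_segment (P (i, i)) (P (i, j)) \<inter> closed_segment (P (k, k)) (P (k, l)) = {}"
    "closed_segment (P (i, i)) (P (i, j)) \<inter> closed_segment (P (k, l)) (P (l, l)) = {}"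
    "closed_segment (P (i, j)) (P (j, j)) \<inter> closed_segment (P (k, k)) (P (k, l)) = {}"
    "closed_segment (P (i, j)) (P (j, j)) \<inter> closed_segment (P (k, l)) (P (l, l)) = {}"
    using d by (auto simp: E_def P_def)
  from this[THEN no[rotated 5]] show False using cr lt d by (auto simp: I_def)
qed

section \<open>Four homothetic copies with a common point\<close>

text \<open>Join interior points of the five bodies through the contact points. As half-open edges stay in
  the interior of a body, two edges without a common vertex can meet only if both bends
  coincide.\<close>

lemma five_touching_bodies_common_point:
  fixes A :: "nat \<Rightarrow> (real^2) set"
  assumes body: "\<And>i. i < 5 \<Longrightarrow> convex_body (A i)"
    and touch: "\<And>i j. i < 5 \<Longrightarrow> j < 5 \<Longrightarrow> i \<noteq> j \<Longrightarrow> touch (A i) (A j)"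
  shows "\<exists>i j k l. i < 5 \<and> j < 5 \<and> k < 5 \<and> l < 5 \<and> distinct [i, j, k, l] \<and>
    A i \<inter> A j \<inter> A k \<inter> A l \<noteq> {}"
proof -
  define v where "v i = (SOME x. x \<in> interior (A i))" for i
  define m where "m i j = (SOME x. x \<in> A i \<inter> A j)" for i j
  have v: "v i \<in> interior (A i)" if "i < 5" for i
    using body[OF that] unfolding v_def convex_body_def by (metis some_in_eq)
  have m: "m i j \<in> A i \<inter> A j" if "i < 5" "j < 5" "i \<noteq> j" for i j
    using touch[OF that] unfolding m_def touch_def by (metis some_in_eq)
  have half: "closed_segment (v i) p \<subseteq> interior (A i) \<union> {p}" if "i < 5" "p \<in> A i" for i p
  proof -
    have "open_segment (v i) p \<subseteq> interior (A i)"
      using body[OF that(1)] v[OF that(1)] that(2) closure_subset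
      by (intro in_interior_closure_convex_segment) (auto simp: convex_body_def)
    then show ?thesis using v[OF that(1)] by (auto simp: closed_segment_eq_open)
  qed
  define E where "E i j = closed_segment (v i) (m i j) \<union> closed_segment (m i j) (v j)" for i j
  have E: "E i j \<subseteq> interior (A i) \<union> interior (A j) \<union> {m i j}" if "i < 5" "j < 5" "i \<noteq> j" for i j
    using half[of i "m i j"] half[of j "m i j"] m[OF that] that
    by (auto simp: E_def closed_segment_commute)
  have dis: "interior (A i) \<inter> A j = {}" if "i < 5" "j < 5" "i \<noteq> j" for i j
    using interior_disjoint_convex_body[OF body[OF that(2)]] touch[OF that] by (simp add: touch_def)
  obtain i j k l where ijkl: "i < 5" "j < 5" "k < 5" "l < 5" "distinct [i, j, k, l]" "E i j \<inter> E k l \<noteq> {}"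
    using crossing_bent_complete_graph[of v m] unfolding E_def by blast
  then obtain x where x: "x \<in> E i j" "x \<in> E k l" by blast
  have ne: "i \<noteq> j" "k \<noteq> l" "i \<noteq> k" "i \<noteq> l" "j \<noteq> k" "j \<noteq> l" using ijkl(5) by auto
  have "x \<in> A i \<union> A j" "x \<in> A k \<union> A l"
    using x E[of i j] E[of k l] m[of i j] m[of k l] ijkl ne interior_subset by blast+
  then have "x = m i j" "x = m k l"
    using x E[of i j] E[of k l] dis[of i k] dis[of i l] dis[of j k] dis[of j l]
      dis[of k i] dis[of l i] dis[of k j] dis[of l j] ijkl(1-4) ne by blast+
  then have "x \<in> A i \<inter> A j \<inter> A k \<inter> A l"
    using m[of i j] m[of k l] ijkl(1-4) ne by auto
  then show ?thesis using ijkl by blast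
qed

text \<open>The interiors of the cones spanned by \<open>K\<close> at \<open>y\<close> and at \<open>y'\<close>, moved to a common apex, are
  disjoint.\<close>

definition cones_disjoint :: "(real^2) set \<Rightarrow> real^2 \<Rightarrow> real^2 \<Rightarrow> bool" where
  "cones_disjoint K y y' \<longleftrightarrow> (\<forall>z\<in>interior K. \<forall>w\<in>K. \<forall>l>0. z - y \<noteq> l *\<^sub>R (w - y'))"

text \<open>A direction in the interiors of both cones could be followed for a short while from the common
  point of the copies, inside both.\<close>

lemma cones_disjoint_homothets:
  assumes K: "convex_body K" and c: "c > 0" "c' > 0" and y: "y \<in> K" "y' \<in> K"
    and q: "c *\<^sub>R y + t = c' *\<^sub>R y' + t'"
    and dis: "interior ((\<lambda>x. c *\<^sub>R x + t) ` K) \<inter> interior ((\<lambda>x. c' *\<^sub>R x + t') ` K) = {}"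
  shows "cones_disjoint K y y'"
  unfolding cones_disjoint_def
proof (intro ballI allI impI notI)
  fix z w l assume z: "z \<in> interior K" and w: "w \<in> K" and l: "(l::real) > 0" and eq: "z - y = l *\<^sub>R (w - y')"
  have cv: "convex K" using K by (simp add: convex_body_def)
  define s where "s = min 1 (c' / (c * l))"
  have s: "0 < s" "s \<le> 1" using c l by (auto simp: s_def)
  define s' where "s' = s * c * l / c'"
  have s': "0 < s'" "s' \<le> 1"
    using s c l by (auto simp: s'_def s_def min_def field_simps)
  have "y - s *\<^sub>R (y - z) \<in> interior K" by (rule mem_interior_convex_shrink[OF cv z y(1) s])
  then have "c *\<^sub>R (y - s *\<^sub>R (y - z)) + t \<in> interior ((\<lambda>x. c *\<^sub>R x + t) ` K)"
    using c by (simp add: interior_homothet)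
  moreover have "(1 - s') *\<^sub>R y' + s' *\<^sub>R w \<in> K" using s' y w by (intro convexD_alt[OF cv]) auto
  then have "c' *\<^sub>R ((1 - s') *\<^sub>R y' + s' *\<^sub>R w) + t' \<in> (\<lambda>x. c' *\<^sub>R x + t') ` K" by blast
  moreover have "c *\<^sub>R (y - s *\<^sub>R (y - z)) + t = c' *\<^sub>R ((1 - s') *\<^sub>R y' + s' *\<^sub>R w) + t'"
  proof -
    have "c *\<^sub>R (y - s *\<^sub>R (y - z)) + t = (c *\<^sub>R y + t) + (c * s) *\<^sub>R (z - y)"
      by (simp add: algebra_simps)
    also have "\<dots> = (c' *\<^sub>R y' + t') + (c' * s') *\<^sub>R (w - y')"
      unfolding q eq using c by (simp add: s'_def mult.commute mult.left_commute)
    also have "\<dots> = c' *\<^sub>R ((1 - s') *\<^sub>R y' + s' *\<^sub>R w) + t'"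
      by (simp add: algebra_simps)
    finally show ?thesis .
  qed
  moreover have "interior ((\<lambda>x. c *\<^sub>R x + t) ` K) \<inter> (\<lambda>x. c' *\<^sub>R x + t') ` K = {}"
    by (rule interior_disjoint_convex_body[OF convex_body_homothet[OF K c(2)] dis])
  ultimately show False by auto
qed

text \<open>If \<open>y\<close> lay on a segment from \<open>y'\<close> into \<open>K\<close>, shrinking \<open>K\<close> towards the other end of
  that segment would carry \<open>y'\<close> to \<open>y\<close>.\<close>

lemma cones_disjoint_not_between:
  assumes K: "convex_body K" and dis: "cones_disjoint K y y'" and r: "r \<in> K" and l: "0 < l" "l \<le> 1"
  shows "y \<noteq> l *\<^sub>R y' + (1 - l) *\<^sub>R r"
proof
  assume y: "y = l *\<^sub>R y' + (1 - l) *\<^sub>R r"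
  obtain z where z: "z \<in> interior K" using K by (auto simp: convex_body_def)
  have "r - l *\<^sub>R (r - z) \<in> interior K"
    using K by (intro mem_interior_convex_shrink z r l) (simp add: convex_body_def)
  moreover have "(r - l *\<^sub>R (r - z)) - y = l *\<^sub>R (z - y')" by (simp add: y algebra_simps)
  ultimately show False
    using dis l z interior_subset unfolding cones_disjoint_def by blast
qed

lemma convex_hull_finite_segment:
  assumes "finite P" "P \<subseteq> K" "convex K" "x \<in> convex hull P"
  shows "\<exists>p\<in>P. \<exists>r\<in>K. \<exists>l. 0 < l \<and> l \<le> 1 \<and> x = l *\<^sub>R p + (1 - l) *\<^sub>R r"
  using assms
proof (induction P arbitrary: x rule: finite_induct)
  case empty
  then show ?case by simp
next
  case (insert p F)
  show ?case
  proof (cases "F = {}")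
    case True
    then show ?thesis using insert.prems by (auto intro!: exI[of _ "1::real"])
  next
    case False
    then obtain u w b where u: "0 \<le> u" "0 \<le> w" "u + w = 1" and b: "b \<in> convex hull F" and x: "x = u *\<^sub>R p + w *\<^sub>R b"
      using insert.prems(3) unfolding convex_hull_insert[OF False] by blast
    have bK: "b \<in> K" using b hull_minimal[of F K convex] insert.prems by blast
    show ?thesis
    proof (cases "u = 0")
      case True
      then show ?thesis using insert.IH[OF _ _ b] insert.prems x u by auto
    next
      case False
      moreover have "w = 1 - u" using u by simp
      ultimately show ?thesis using u x bK by (intro bexI[of _ p] bexI[of _ b] exI[of _ u]) auto
    qed
  qed
qed

lemma basis_coordinates:
  fixes u v :: "real^2"
  assumes "u \<noteq> 0" "\<And>k. v \<noteq> k *\<^sub>R u"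
  obtains m n where "\<And>x. x = inner m x *\<^sub>R u + inner n x *\<^sub>R v"
    "\<And>p q. inner m (p *\<^sub>R u + q *\<^sub>R v) = p" "\<And>p q. inner n (p *\<^sub>R u + q *\<^sub>R v) = q"
proof -
  define D where "D = u$1 * v$2 - u$2 * v$1"
  have D: "D \<noteq> 0"
  proof
    assume D0: "D = 0"
    define k where "k = (if u$1 = 0 then v$2 / u$2 else v$1 / u$1)"
    have "v = k *\<^sub>R u"
      using assms(1) D0 unfolding vec_eq_iff forall_2 k_def D_def by (auto simp: field_simps)
    then show False using assms(2) by blast
  qed
  define m :: "real^2" where "m = vector [v$2 / D, - v$1 / D]"
  define n :: "real^2" where "n = vector [- u$2 / D, u$1 / D]"
  have im: "inner m x = (v$2 * x$1 - v$1 * x$2) / D" and "inner n x = (u$1 * x$2 - u$2 * x$1) / D" for x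
    by (simp_all add: m_def n_def inner_vec_def sum_2 diff_divide_distrib)
  note inn = this
  have 1: "x = inner m x *\<^sub>R u + inner n x *\<^sub>R v" for x
  proof -
    have Dmn: "D * inner m x = v$2 * x$1 - v$1 * x$2" "D * inner n x = u$1 * x$2 - u$2 * x$1"
      using D by (simp_all add: inn)
    have "D *\<^sub>R x = (D * inner m x) *\<^sub>R u + (D * inner n x) *\<^sub>R v"
      unfolding Dmn vec_eq_iff forall_2 by (simp add: D_def algebra_simps)
    also have "\<dots> = D *\<^sub>R (inner m x *\<^sub>R u + inner n x *\<^sub>R v)" by (simp add: scaleR_add_right)
    finally show ?thesis using D by simp
  qed
  have 2: "inner m (p *\<^sub>R u + q *\<^sub>R v) = p" and 3: "inner n (p *\<^sub>R u + q *\<^sub>R v) = q" for p q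
    unfolding inn using D by (simp_all add: field_simps) (simp_all add: D_def algebra_simps)
  show ?thesis by (rule that[OF 1 2 3])
qed

lemma interior_towards_center:
  fixes ctr :: "real^2"
  assumes "convex_body K" "ctr \<in> interior K" "ctr + w \<in> K" "0 \<le> k" "k < 1"
  shows "ctr + k *\<^sub>R w \<in> interior K"
proof -
  have "(ctr + w) - (1 - k) *\<^sub>R ((ctr + w) - ctr) \<in> interior K"
    using assms by (intro mem_interior_convex_shrink) (auto simp: convex_body_def)
  moreover have "(ctr + w) - (1 - k) *\<^sub>R ((ctr + w) - ctr) = ctr + k *\<^sub>R w"
    by (simp add: algebra_simps)
  ultimately show ?thesis by metis
qed

text \<open>Here \<open>x x'\<close> and \<open>y y'\<close> are diagonals crossing at \<open>ctr\<close>. For \<open>\<rho> \<sigma> > 1\<close> the direction from \<open>y\<close>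
  to \<open>x'\<close> would point from \<open>x\<close> to an interior point on the segment from \<open>ctr\<close> to \<open>y'\<close>, and so lie in both
  cones.\<close>

lemma cones_disjoint_diagonal_ratios:
  assumes K: "convex_body K" "ctr \<in> interior K" and pos: "\<rho> > 0" "\<sigma> > 0"
    and x': "x' \<in> K" "x' = ctr - \<rho> *\<^sub>R (x - ctr)" and y': "y' \<in> K" "y' = ctr - \<sigma> *\<^sub>R (y - ctr)"
    and dis: "cones_disjoint K x y"
  shows "\<rho> * \<sigma> \<le> 1"
proof (rule ccontr)
  assume gt: "\<not> \<rho> * \<sigma> \<le> 1"
  have "ctr + (1 / (\<rho> * \<sigma>)) *\<^sub>R (- \<sigma> *\<^sub>R (y - ctr)) \<in> interior K"
    using pos y' gt by (intro interior_towards_center[OF K]) auto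
  then have "ctr - (1 / \<rho>) *\<^sub>R (y - ctr) \<in> interior K" using pos by simp
  moreover have "(ctr - (1 / \<rho>) *\<^sub>R (y - ctr)) - x = (1 / \<rho>) *\<^sub>R (x' - y)"
    unfolding x'(2) using pos by (simp add: algebra_simps)
  moreover have "1 / \<rho> > 0" using pos by simp
  ultimately show False using dis x'(1) unfolding cones_disjoint_def by blast
qed

text \<open>If \<open>X + Y > 1\<close>, the direction to the extra point from \<open>ctr + v\<close> lies in the cone at \<open>ctr - u\<close>, or
  the direction to it from \<open>ctr + u\<close> lies in the cone at \<open>ctr - v\<close>, depending on whether
  \<open>Y - 1 < X\<close>.\<close>

lemma cones_disjoint_diamond_bound:
  assumes K: "convex_body K" "ctr \<in> interior K"
    and pts: "ctr + u \<in> K" "ctr - u \<in> K" "ctr + v \<in> K" "ctr - v \<in> K"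
    and dis: "cones_disjoint K (ctr - u) (ctr + v)" "cones_disjoint K (ctr - v) (ctr + u)"
    and X: "0 \<le> X" and Y: "0 \<le> Y" and r: "ctr + X *\<^sub>R u + Y *\<^sub>R v \<in> K"
  shows "X + Y \<le> 1"
proof (rule ccontr)
  assume gt: "\<not> X + Y \<le> 1"
  have inside: "ctr + k *\<^sub>R w \<in> interior K" if "\<bar>k\<bar> < 1" "ctr + w \<in> K" "ctr - w \<in> K" for k w
    using interior_towards_center[OF K that(2), of k] interior_towards_center[OF K, of "- w" "- k"] that
    by (cases "k \<ge> 0") auto
  show False
  proof (cases "Y - 1 < X")
    case True
    then have X0: "X > 0" using gt by linarith
    have "\<bar>(Y - 1) / X\<bar> < 1" using True gt X0 by (simp add: abs_less_iff field_simps)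
    then have "ctr + ((Y - 1) / X) *\<^sub>R v \<in> interior K" using pts by (intro inside)
    moreover have "(ctr + ((Y - 1) / X) *\<^sub>R v) - (ctr - u) = (1 / X) *\<^sub>R ((ctr + X *\<^sub>R u + Y *\<^sub>R v) - (ctr + v))"
      using X0 by (simp add: algebra_simps diff_divide_distrib)
    moreover have "1 / X > 0" using X0 by simp
    ultimately show False using dis(1) r unfolding cones_disjoint_def by blast
  next
    case False
    then have Y0: "Y > 0" using X by linarith
    have "\<bar>(X - 1) / Y\<bar> < 1" using False gt Y0 X by (simp add: abs_less_iff field_simps)
    then have "ctr + ((X - 1) / Y) *\<^sub>R u \<in> interior K" using pts by (intro inside)
    moreover have "(ctr + ((X - 1) / Y) *\<^sub>R u) - (ctr - v) = (1 / Y) *\<^sub>R ((ctr + X *\<^sub>R u + Y *\<^sub>R v) - (ctr + u))"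
      using Y0 by (simp add: algebra_simps diff_divide_distrib)
    moreover have "1 / Y > 0" using Y0 by simp
    ultimately show False using dis(2) r unfolding cones_disjoint_def by blast
  qed
qed


text \<open>Applied to the four sides of the quadrilateral, the ratio bound forces the diagonals to bisect each
  other. The diamond bound then keeps \<open>K\<close> within the resulting parallelogram, whose sides are
  parallel to the zero sets of the sum and the difference of the coordinates along the diagonals.\<close>

lemma parallelogram_of_crossing_diagonals:
  assumes K: "convex_body K" and abcd: "a \<in> K" "b \<in> K" "c \<in> K" "d \<in> K"
    and dis: "\<And>x y. x \<in> {a, b, c, d} \<Longrightarrow> y \<in> {a, b, c, d} \<Longrightarrow> x \<noteq> y \<Longrightarrow> cones_disjoint K x y"
    and ne: "distinct [a, b, c, d]"
    and ctr: "ctr \<in> closed_segment a b" "ctr \<in> closed_segment c d"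
  shows "\<exists>m n p r. (\<forall>s t. \<exists>x. inner m x = s \<and> inner n x = t) \<and>
    K = {x. \<bar>inner m x - p\<bar> \<le> 1 \<and> \<bar>inner n x - r\<bar> \<le> 1}"
proof -
  have cv: "convex K" using K by (simp add: convex_body_def)
  have nb: "x \<noteq> l *\<^sub>R y + (1 - l) *\<^sub>R r"
    if "x \<in> {a, b, c, d}" "y \<in> {a, b, c, d}" "x \<noteq> y" "r \<in> K" "0 < l" "l \<le> 1" for x y r l
    using cones_disjoint_not_between[OF K dis[OF that(1-3)] that(4-6)] .
  obtain s where s: "0 \<le> s" "s \<le> 1" "ctr = (1 - s) *\<^sub>R a + s *\<^sub>R b"
    using ctr(1) by (auto simp: closed_segment_def)
  obtain t where t: "0 \<le> t" "t \<le> 1" "ctr = (1 - t) *\<^sub>R c + t *\<^sub>R d"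
    using ctr(2) by (auto simp: closed_segment_def)
  have ctrK: "ctr \<in> K" using closed_segment_subset[OF abcd(1,2) cv] ctr(1) by blast
  have off: "x \<notin> closed_segment y z" if "x \<in> {a, b, c, d}" "y \<in> {a, b, c, d}" "z \<in> {a, b, c, d}" "x \<noteq> y" "x \<noteq> z" for x y z
  proof
    assume "x \<in> closed_segment y z"
    then obtain l where l: "0 \<le> l" "l \<le> 1" "x = (1 - l) *\<^sub>R y + l *\<^sub>R z" by (auto simp: closed_segment_def)
    have "z \<in> K" using that abcd by auto
    then show False
      using nb[OF that(1,2,4), of z "1 - l"] l that(5) by (cases "l = 1") auto
  qed
  have notv: "ctr \<noteq> a" "ctr \<noteq> b" "ctr \<noteq> c" "ctr \<noteq> d"
    using off[of a c d] off[of b c d] off[of c a b] off[of d a b] ctr ne by auto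
  then have s01: "0 < s" "s < 1" and t01: "0 < t" "t < 1"
    using s t by (auto simp: less_le)
  define u v where "u = a - ctr" and "v = c - ctr"
  define \<rho> \<sigma> where "\<rho> = (1 - s) / s" and "\<sigma> = (1 - t) / t"
  have pos: "\<rho> > 0" "\<sigma> > 0" using s01 t01 by (auto simp: \<rho>_def \<sigma>_def)
  have a: "a = ctr + u" and c: "c = ctr + v" by (simp_all add: u_def v_def)
  have b: "b = ctr - \<rho> *\<^sub>R u"
  proof -
    have "s *\<^sub>R b = s *\<^sub>R (ctr - \<rho> *\<^sub>R u)"
      using s01 by (simp add: scaleR_diff_right \<rho>_def u_def) (simp add: s(3) algebra_simps)
    then show ?thesis using s01 by simp
  qed
  have d: "d = ctr - \<sigma> *\<^sub>R v"
  proof -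
    have "t *\<^sub>R d = t *\<^sub>R (ctr - \<sigma> *\<^sub>R v)"
      using t01 by (simp add: scaleR_diff_right \<sigma>_def v_def) (simp add: t(3) algebra_simps)
    then show ?thesis using t01 by simp
  qed
  have not_ray: "y \<noteq> ctr + k *\<^sub>R u" if "y \<in> {c, d}" "k > 0" for y k
  proof
    assume y: "y = ctr + k *\<^sub>R u"
    have ya: "y \<in> {a, b, c, d}" "a \<in> {a, b, c, d}" "y \<noteq> a" using that ne by auto
    show False
    proof (cases "k \<le> 1")
      case True
      have "y = k *\<^sub>R a + (1 - k) *\<^sub>R ctr" by (simp add: y a algebra_simps)
      then show False using nb[OF ya ctrK, of k] True that by blast
    next
      case False
      have "a = (1 / k) *\<^sub>R y + (1 - 1 / k) *\<^sub>R ctr" using that(2) by (simp add: y a algebra_simps)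
      then show False using nb[OF ya(2,1) ya(3)[symmetric] ctrK, of "1 / k"] False by simp
    qed
  qed
  have u0: "u \<noteq> 0" using notv(1) by (simp add: a)
  have indep: "v \<noteq> k *\<^sub>R u" for k
  proof
    assume v: "v = k *\<^sub>R u"
    consider "k = 0" | "k > 0" | "k < 0" by linarith
    then show False
    proof cases
      case 1
      then show False using v notv(3) by (simp add: c)
    next
      case 2
      then show False using not_ray[of c k] by (simp add: c v)
    next
      case 3
      then show False using not_ray[of d "- \<sigma> * k"] pos by (simp add: d v mult_pos_neg)
    qed
  qed
  obtain m n where mn: "\<And>x. x = inner m x *\<^sub>R u + inner n x *\<^sub>R v"
    "\<And>p q. inner m (p *\<^sub>R u + q *\<^sub>R v) = p" "\<And>p q. inner n (p *\<^sub>R u + q *\<^sub>R v) = q"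
    using basis_coordinates[OF u0 indep] by metis
  \<comment> \<open>Seen from an interior point \<open>z\<close>, there are points of \<open>K\<close> behind \<open>ctr\<close>: midpoints of points on the
    two diagonals.\<close>
  have ctri: "ctr \<in> interior K"
  proof -
    obtain z where z: "z \<in> interior K" using K by (auto simp: convex_body_def)
    define X Y where "X = inner m (z - ctr)" and "Y = inner n (z - ctr)"
    have zc: "z = ctr + X *\<^sub>R u + Y *\<^sub>R v" using mn(1)[of "z - ctr"] by (simp add: X_def Y_def algebra_simps)
    define g where "g = min (min \<rho> \<sigma>) 1"
    define N where "N = \<bar>X\<bar> + \<bar>Y\<bar> + 1"
    have N: "N > 0" "\<bar>X\<bar> \<le> N" "\<bar>Y\<bar> \<le> N" by (auto simp: N_def)
    define e where "e = g / (2 * N)"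
    have g: "g > 0" "g \<le> \<rho>" "g \<le> \<sigma>" "g \<le> 1" using pos by (auto simp: g_def)
    have e: "e > 0" using g N by (simp add: e_def)
    have "2 * e * N = g" using N by (simp add: e_def)
    then have "2 * e * \<bar>X\<bar> \<le> g" "2 * e * \<bar>Y\<bar> \<le> g"
      using e N(2,3) mult_left_mono[of "\<bar>X\<bar>" N "2 * e"] mult_left_mono[of "\<bar>Y\<bar>" N "2 * e"] by simp_all
    then have bd: "\<bar>2 * e * X\<bar> \<le> g" "\<bar>2 * e * Y\<bar> \<le> g" using e by (simp_all add: abs_mult)
    have line: "ctr + k *\<^sub>R w \<in> K"
      if "\<bar>k\<bar> \<le> g" "ctr + w \<in> K" "ctr - h *\<^sub>R w \<in> K" "g \<le> h" for k h w
    proof (cases "k \<ge> 0")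
      case True
      have "(1 - k) *\<^sub>R ctr + k *\<^sub>R (ctr + w) \<in> K" using True that(1,2) g by (intro convexD_alt[OF cv ctrK]) auto
      then show ?thesis by (simp add: algebra_simps)
    next
      case False
      have h: "h > 0" using that g by linarith
      have "(1 - (- k / h)) *\<^sub>R ctr + (- k / h) *\<^sub>R (ctr - h *\<^sub>R w) \<in> K"
        using False that h by (intro convexD_alt[OF cv ctrK]) (auto simp: field_simps)
      then show ?thesis using h by (simp add: algebra_simps)
    qed
    have "ctr + (- 2 * e * X) *\<^sub>R u \<in> K" "ctr + (- 2 * e * Y) *\<^sub>R v \<in> K"
      using line[of "- 2 * e * X" u \<rho>] line[of "- 2 * e * Y" v \<sigma>] bd g abcd by (simp_all add: a b c d)
    then have "(1 - 1/2) *\<^sub>R (ctr + (- 2 * e * X) *\<^sub>R u) + (1/2) *\<^sub>R (ctr + (- 2 * e * Y) *\<^sub>R v) \<in> K"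
      by (intro convexD_alt[OF cv]) auto
    moreover have "(1 - 1/2) *\<^sub>R (ctr + (- 2 * e * X) *\<^sub>R u) + (1/2) *\<^sub>R (ctr + (- 2 * e * Y) *\<^sub>R v) = ctr - e *\<^sub>R (z - ctr)"
      unfolding zc vec_eq_iff forall_2 by (simp add: algebra_simps)
    ultimately have w: "ctr - e *\<^sub>R (z - ctr) \<in> K" by metis
    have "(ctr - e *\<^sub>R (z - ctr)) - (e / (1 + e)) *\<^sub>R ((ctr - e *\<^sub>R (z - ctr)) - z) \<in> interior K"
      using e by (intro mem_interior_convex_shrink[OF cv z w]) auto
    moreover have "(ctr - e *\<^sub>R (z - ctr)) - z = - ((1 + e) *\<^sub>R (z - ctr))" by (simp add: algebra_simps)
    then have "(e / (1 + e)) *\<^sub>R ((ctr - e *\<^sub>R (z - ctr)) - z) = - (e *\<^sub>R (z - ctr))" using e by simp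
    then have "(ctr - e *\<^sub>R (z - ctr)) - (e / (1 + e)) *\<^sub>R ((ctr - e *\<^sub>R (z - ctr)) - z) = ctr" by simp
    ultimately show ?thesis by metis
  qed
  have opp: "b = ctr - \<rho> *\<^sub>R (a - ctr)" "d = ctr - \<sigma> *\<^sub>R (c - ctr)"
    "a = ctr - (1 / \<rho>) *\<^sub>R (b - ctr)" "c = ctr - (1 / \<sigma>) *\<^sub>R (d - ctr)"
    using pos by (simp_all add: a b c d)
  have pos': "1 / \<rho> > 0" "1 / \<sigma> > 0" using pos by simp_all
  have adj: "cones_disjoint K a c" "cones_disjoint K a d" "cones_disjoint K b c" "cones_disjoint K b d" 
    "cones_disjoint K d a" "cones_disjoint K c a" "cones_disjoint K d b" "cones_disjoint K c b"
    using dis ne by auto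
  note ratios = cones_disjoint_diagonal_ratios[OF K ctri]
  have "\<rho> * \<sigma> \<le> 1" by (rule ratios[OF pos abcd(2) opp(1) abcd(4) opp(2) adj(1)])
  moreover have "1 / \<rho> * (1 / \<sigma>) \<le> 1" by (rule ratios[OF pos' abcd(1) opp(3) abcd(3) opp(4) adj(4)])
  moreover have "\<rho> * (1 / \<sigma>) \<le> 1"
    by (rule ratios[OF pos(1) pos'(2) abcd(2) opp(1) abcd(3) opp(4) adj(2)])
  moreover have "1 / \<rho> * \<sigma> \<le> 1"
    by (rule ratios[OF pos'(1) pos(2) abcd(1) opp(3) abcd(4) opp(2) adj(3)])
  ultimately have eqs: "\<rho> * \<sigma> = 1" "\<rho> = \<sigma>" using pos by (auto simp: field_simps)
  then have "(\<rho> - 1) * (\<rho> + 1) = 0" by (simp add: algebra_simps)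
  then have "\<rho> = 1" using pos by auto
  then have r1: "\<rho> = 1" "\<sigma> = 1" using eqs by simp_all
  have b1: "b = ctr - u" and d1: "d = ctr - v" using b d r1 by simp_all
  have bound: "\<bar>X\<bar> + \<bar>Y\<bar> \<le> 1" if r: "ctr + X *\<^sub>R u + Y *\<^sub>R v \<in> K" for X Y
  proof -
    have "\<bar>X\<bar> + \<bar>Y\<bar> \<le> 1"
      if u': "u' = u \<or> u' = - u" and v': "v' = v \<or> v' = - v" and r': "ctr + \<bar>X\<bar> *\<^sub>R u' + \<bar>Y\<bar> *\<^sub>R v' \<in> K" for u' v'
    proof (rule cones_disjoint_diamond_bound[OF K ctri _ _ _ _ _ _ _ _ r'])
      show "ctr + u' \<in> K" "ctr - u' \<in> K" "ctr + v' \<in> K" "ctr - v' \<in> K"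
        using u' v' abcd by (auto simp: a b1 c d1)
      show "cones_disjoint K (ctr - u') (ctr + v')" "cones_disjoint K (ctr - v') (ctr + u')"
        using u' v' adj by (auto simp: a b1 c d1)
    qed auto
    moreover have "\<bar>X\<bar> *\<^sub>R (if X \<ge> 0 then u else - u) = X *\<^sub>R u" "\<bar>Y\<bar> *\<^sub>R (if Y \<ge> 0 then v else - v) = Y *\<^sub>R v"
      by auto
    ultimately show ?thesis using r by metis
  qed
  have inK: "ctr + X *\<^sub>R u + Y *\<^sub>R v \<in> K" if XY: "\<bar>X\<bar> + \<bar>Y\<bar> \<le> 1" for X Y
  proof -
    define u' v' where "u' = (if X \<ge> 0 then u else - u)" and "v' = (if Y \<ge> 0 then v else - v)"
    have K': "ctr + u' \<in> K" "ctr + v' \<in> K" using abcd by (auto simp: u'_def v'_def a b1 c d1)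
    have "(1 - \<bar>X\<bar> - \<bar>Y\<bar>) *\<^sub>R ctr + \<bar>X\<bar> *\<^sub>R (ctr + u') + \<bar>Y\<bar> *\<^sub>R (ctr + v') \<in> convex hull {ctr, ctr + u', ctr + v'}"
      unfolding convex_hull_3 mem_Collect_eq using XY
      by (intro exI[of _ "1 - \<bar>X\<bar> - \<bar>Y\<bar>"] exI[of _ "\<bar>X\<bar>"] exI[of _ "\<bar>Y\<bar>"]) auto
    then have "(1 - \<bar>X\<bar> - \<bar>Y\<bar>) *\<^sub>R ctr + \<bar>X\<bar> *\<^sub>R (ctr + u') + \<bar>Y\<bar> *\<^sub>R (ctr + v') \<in> K"
      using hull_minimal[of "{ctr, ctr + u', ctr + v'}" K convex] cv K' ctrK by blast
    moreover have "(1 - \<bar>X\<bar> - \<bar>Y\<bar>) *\<^sub>R ctr + \<bar>X\<bar> *\<^sub>R (ctr + u') + \<bar>Y\<bar> *\<^sub>R (ctr + v') = ctr + \<bar>X\<bar> *\<^sub>R u' + \<bar>Y\<bar> *\<^sub>R v'"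
      by (simp add: algebra_simps)
    moreover have "\<bar>X\<bar> *\<^sub>R u' = X *\<^sub>R u" "\<bar>Y\<bar> *\<^sub>R v' = Y *\<^sub>R v" by (auto simp: u'_def v'_def)
    ultimately show ?thesis by metis
  qed
  have mem: "x \<in> K \<longleftrightarrow> \<bar>inner m (x - ctr)\<bar> + \<bar>inner n (x - ctr)\<bar> \<le> 1" for x
  proof -
    have "x = ctr + inner m (x - ctr) *\<^sub>R u + inner n (x - ctr) *\<^sub>R v"
      using mn(1)[of "x - ctr"] by (simp add: algebra_simps)
    then show ?thesis using bound[of "inner m (x - ctr)" "inner n (x - ctr)"] inK[of "inner m (x - ctr)" "inner n (x - ctr)"] by metis
  qed
  have "K = {x. \<bar>inner (m + n) x - inner (m + n) ctr\<bar> \<le> 1 \<and> \<bar>inner (m - n) x - inner (m - n) ctr\<bar> \<le> 1}"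
  proof -
    have "\<bar>X\<bar> + \<bar>Y\<bar> \<le> 1 \<longleftrightarrow> \<bar>X + Y\<bar> \<le> 1 \<and> \<bar>X - Y\<bar> \<le> 1" for X Y :: real by linarith
    moreover have "inner (m + n) x - inner (m + n) ctr = inner m (x - ctr) + inner n (x - ctr)"
      "inner (m - n) x - inner (m - n) ctr = inner m (x - ctr) - inner n (x - ctr)" for x
      by (simp_all add: inner_add_left inner_diff_left inner_diff_right)
    ultimately show ?thesis using mem by (intro set_eqI) (simp only: mem_Collect_eq)
  qed
  moreover have "\<exists>x. inner (m + n) x = s \<and> inner (m - n) x = t" for s t
    by (rule exI[of _ "((s + t) / 2) *\<^sub>R u + ((s - t) / 2) *\<^sub>R v"])
      (simp only: inner_add_left inner_diff_left mn(2,3), simp add: field_simps)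
  ultimately show ?thesis by blast
qed

text \<open>None of the four preimages of \<open>q\<close> is in the convex hull of the others, so their Radon partition
  is two against two, which gives the crossing diagonals.\<close>

lemma parallelogram_of_four_homothets_at_point:
  fixes K :: "(real^2) set" and c :: "nat \<Rightarrow> real" and t :: "nat \<Rightarrow> real^2"
  assumes K: "convex_body K" and I: "card I = 4" and c: "\<And>i. i \<in> I \<Longrightarrow> c i > 0"
    and q: "\<And>i. i \<in> I \<Longrightarrow> q \<in> (\<lambda>x. c i *\<^sub>R x + t i) ` K"
    and dis: "\<And>i j. i \<in> I \<Longrightarrow> j \<in> I \<Longrightarrow> i \<noteq> j \<Longrightarrow>
      interior ((\<lambda>x. c i *\<^sub>R x + t i) ` K) \<inter> interior ((\<lambda>x. c j *\<^sub>R x + t j) ` K) = {}"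
  shows "\<exists>m n p r. (\<forall>s t. \<exists>x. inner m x = s \<and> inner n x = t) \<and>
    K = {x. \<bar>inner m x - p\<bar> \<le> 1 \<and> \<bar>inner n x - r\<bar> \<le> 1}"
proof -
  have cv: "convex K" using K by (simp add: convex_body_def)
  obtain y where y: "\<And>i. i \<in> I \<Longrightarrow> y i \<in> K" "\<And>i. i \<in> I \<Longrightarrow> q = c i *\<^sub>R y i + t i"
    using q unfolding image_iff by metis
  have cd: "cones_disjoint K (y i) (y j)" if "i \<in> I" "j \<in> I" "i \<noteq> j" for i j
    using that y c dis by (intro cones_disjoint_homothets[where c = "c i" and c' = "c j" and t = "t i" and t' = "t j"] K) auto
  have "inj_on y I"
  proof (rule inj_onI, rule ccontr)
    fix i j assume ij: "i \<in> I" "j \<in> I" "y i = y j" "i \<noteq> j"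
    then show False
      using cones_disjoint_not_between[OF K cd[OF ij(1,2,4)] y(1)[OF ij(1)], of 1] by simp
  qed
  define Y where "Y = y ` I"
  have Y: "card Y = 4" "finite Y" "Y \<subseteq> K"
    using \<open>inj_on y I\<close> I y(1) by (auto simp: Y_def card_image card_ge_0_finite)
  have cdY: "cones_disjoint K x z" if "x \<in> Y" "z \<in> Y" "x \<noteq> z" for x z
    using that cd by (auto simp: Y_def)
  have outside: "x \<notin> convex hull P" if "x \<in> Y" "P \<subseteq> Y - {x}" for x P
  proof
    assume "x \<in> convex hull P"
    moreover have "finite P" "P \<subseteq> K" using that Y finite_subset[of P Y] by auto
    ultimately obtain z r l where zrl: "z \<in> P" "r \<in> K" "0 < l" "l \<le> 1" "x = l *\<^sub>R z + (1 - l) *\<^sub>R r"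
      using convex_hull_finite_segment[OF _ _ cv] by metis
    then have "z \<in> Y" "x \<noteq> z" using that by auto
    then show False using cones_disjoint_not_between[OF K cdY zrl(2-4)] that(1) zrl(5) by blast
  qed
  have "affine_dependent Y"
    using Y by (intro affine_dependent_biggerset) auto
  then obtain M P where MP: "M \<inter> P = {}" "M \<union> P = Y" "convex hull M \<inter> convex hull P \<noteq> {}"
    using Radon_partition[OF Y(2)] by blast
  have fin: "finite M" "finite P" using Y(2) MP(2) by (metis finite_Un)+
  have card: "card M + card P = 4" using card_Un_disjoint[OF fin MP(1)] MP(2) Y(1) by simp
  have not1: "card M \<noteq> 1" if "M \<inter> P = {}" "M \<union> P = Y" "convex hull M \<inter> convex hull P \<noteq> {}" for M P
  proof
    assume "card M = 1"
    then obtain x where x: "M = {x}" by (auto simp: card_1_singleton_iff)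
    then have "x \<in> Y" "P \<subseteq> Y - {x}" using that by auto
    then show False using outside[of x P] that(3) x by auto
  qed
  have "card M \<noteq> 1" "card P \<noteq> 1" using not1[of M P] not1[of P M] MP by (auto simp: Un_commute Int_commute)
  moreover have "card M \<noteq> 0" "card P \<noteq> 0" using MP(3) fin by auto
  ultimately have "card M = 2" "card P = 2" using card by linarith+
  then obtain a b a' b' where ab: "M = {a, b}" "a \<noteq> b" "P = {a', b'}" "a' \<noteq> b'" by (auto simp: card_2_iff)
  then have eqY: "{a, b, a', b'} = Y" using MP(2) by auto
  obtain ctr where "ctr \<in> closed_segment a b" "ctr \<in> closed_segment a' b'"
    using MP(3) unfolding ab segment_convex_hull by blast
  moreover have "distinct [a, b, a', b']" using ab MP(1) by auto
  moreover have "a \<in> K" "b \<in> K" "a' \<in> K" "b' \<in> K" using Y(3) eqY by auto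
  ultimately show ?thesis
    by (rule_tac parallelogram_of_crossing_diagonals[OF K, of a b a' b' ctr]) (simp_all only: eqY cdY not_False_eq_True)
qed

section \<open>Homothetic copies of a parallelogram\<close>

text \<open>The projections are pairwise meeting intervals, so the largest of their left ends belongs to
  all of them, and each interval extends from there to the right or, as a whole, to the left. Of five
  parallelograms, two do the same in both coordinates and hence overlap.\<close>

lemma five_boxes_overlap:
  fixes m n :: "real^2" and p r c :: "nat \<Rightarrow> real"
  defines "A \<equiv> \<lambda>i. {x. \<bar>inner m x - p i\<bar> \<le> c i \<and> \<bar>inner n x - r i\<bar> \<le> c i}"
  assumes onto: "\<And>s t. \<exists>x. inner m x = s \<and> inner n x = t"
    and c: "\<And>i. i < 5 \<Longrightarrow> c i > 0"
    and meet: "\<And>i j. i < 5 \<Longrightarrow> j < 5 \<Longrightarrow> A i \<inter> A j \<noteq> {}"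
  shows "\<exists>i j. i < 5 \<and> j < 5 \<and> i \<noteq> j \<and> interior (A i) \<inter> interior (A j) \<noteq> {}"
proof -
  define P where "P = Max ((\<lambda>i. p i - c i) ` {..<5::nat})"
  define R where "R = Max ((\<lambda>i. r i - c i) ` {..<5::nat})"
  have meets: "p i - c i \<le> p j + c j" "r i - c i \<le> r j + c j" if ij: "i < 5" "j < 5" for i j
  proof -
    obtain x where "x \<in> A i" "x \<in> A j" using meet[OF ij] by blast
    then show "p i - c i \<le> p j + c j" "r i - c i \<le> r j + c j" by (auto simp: A_def abs_le_iff)
  qed
  have P: "p i - c i \<le> P" "P \<le> p i + c i" if "i < 5" for i
    using that meets(1)[of _ i] unfolding P_def
    by (auto intro!: Max_ge Max.boundedI simp: lessThan_empty_iff)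
  have R: "r i - c i \<le> R" "R \<le> r i + c i" if "i < 5" for i
    using that meets(2)[of _ i] unfolding R_def
    by (auto intro!: Max_ge Max.boundedI simp: lessThan_empty_iff)
  define cl where "cl i = (P < p i + c i, R < r i + c i)" for i
  have "\<not> inj_on cl {..<5::nat}"
  proof
    assume "inj_on cl {..<5::nat}"
    then have "card {..<5::nat} \<le> card (UNIV :: (bool \<times> bool) set)"
      by (intro card_inj_on_le[of cl]) auto
    then show False by (simp add: card_UNIV_bool flip: UNIV_Times_UNIV)
  qed
  then obtain i j where ij: "i < 5" "j < 5" "i \<noteq> j" "cl i = cl j" by (auto simp: inj_on_def)
  have between: "\<exists>s. \<bar>s - a\<bar> < d \<and> \<bar>s - b\<bar> < e"
    if "d > 0" "e > 0" "a - d \<le> Q" "Q \<le> a + d" "b - e \<le> Q" "Q \<le> b + e" "(Q < a + d) = (Q < b + e)"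
    for a b d e Q :: real
  proof -
    have "max (a - d) (b - e) < min (a + d) (b + e)"
      using that by (cases "Q < a + d") auto
    then obtain s where "max (a - d) (b - e) < s" "s < min (a + d) (b + e)" using dense by blast
    then show ?thesis by (intro exI[of _ s]) (auto simp: abs_less_iff)
  qed
  obtain s where s: "\<bar>s - p i\<bar> < c i" "\<bar>s - p j\<bar> < c j"
    using between[OF c[OF ij(1)] c[OF ij(2)] P[OF ij(1)] P[OF ij(2)]] ij(4) by (auto simp: cl_def)
  obtain u where u: "\<bar>u - r i\<bar> < c i" "\<bar>u - r j\<bar> < c j"
    using between[OF c[OF ij(1)] c[OF ij(2)] R[OF ij(1)] R[OF ij(2)]] ij(4) by (auto simp: cl_def)
  obtain x where x: "inner m x = s" "inner n x = u" using onto by blast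
  have int: "x \<in> interior (A k)" if "\<bar>s - p k\<bar> < c k" "\<bar>u - r k\<bar> < c k" for k
  proof (rule interiorI)
    show "open {x. \<bar>inner m x - p k\<bar> < c k \<and> \<bar>inner n x - r k\<bar> < c k}"
      by (intro open_Collect_conj open_Collect_less continuous_intros)
    show "x \<in> {x. \<bar>inner m x - p k\<bar> < c k \<and> \<bar>inner n x - r k\<bar> < c k}" using that x by simp
    show "{x. \<bar>inner m x - p k\<bar> < c k \<and> \<bar>inner n x - r k\<bar> < c k} \<subseteq> A k" by (auto simp: A_def)
  qed
  then show ?thesis using ij(1-3) s u by blast
qed

lemma homothet_of_parallelogram:
  fixes m n :: "'a::real_inner"
  assumes "K = {x. \<bar>inner m x - p\<bar> \<le> 1 \<and> \<bar>inner n x - r\<bar> \<le> 1}" "c > 0"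
  shows "(\<lambda>x. c *\<^sub>R x + t) ` K
    = {x. \<bar>inner m x - (c * p + inner m t)\<bar> \<le> c \<and> \<bar>inner n x - (c * r + inner n t)\<bar> \<le> c}"
proof -
  have scale: "\<bar>inner k (c *\<^sub>R x + t) - (c * w + inner k t)\<bar> \<le> c \<longleftrightarrow> \<bar>inner k x - w\<bar> \<le> 1" for k x w
  proof -
    have "inner k (c *\<^sub>R x + t) - (c * w + inner k t) = c * (inner k x - w)"
      by (simp add: inner_add_right right_diff_distrib)
    then show ?thesis using assms(2) by (simp add: abs_mult)
  qed
  have "x \<in> (\<lambda>x. c *\<^sub>R x + t) ` K \<longleftrightarrow> (1 / c) *\<^sub>R (x - t) \<in> K" for x
    using assms(2) by (auto simp: image_iff intro!: bexI[of _ "(1 / c) *\<^sub>R (x - t)"])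
  moreover have "c *\<^sub>R ((1 / c) *\<^sub>R (x - t)) + t = x" for x using assms(2) by simp
  ultimately show ?thesis
    unfolding assms(1) using scale by (intro set_eqI) (metis (no_types, lifting) mem_Collect_eq)
qed

lemma no_five_touching_copies:
  fixes K :: "(real^2) set" and A :: "nat \<Rightarrow> (real^2) set"
  assumes K: "convex_body K" and hom: "\<And>i. i < 5 \<Longrightarrow> positive_homothetic_copy K (A i)"
  shows "\<exists>i j. i < 5 \<and> j < 5 \<and> i \<noteq> j \<and> \<not> touch (A i) (A j)"
proof (rule ccontr)
  assume "\<not> ?thesis"
  then have touch: "touch (A i) (A j)" if "i < 5" "j < 5" "i \<noteq> j" for i j using that by blast
  have body: "convex_body (A i)" if "i < 5" for i
    using convex_body_homothetic_copy[OF K hom[OF that]] .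
  have dis: "interior (A i) \<inter> interior (A j) = {}" if "i < 5" "j < 5" "i \<noteq> j" for i j
    using touch[OF that] by (simp add: touch_def)
  obtain c t where c: "\<And>i. i < 5 \<Longrightarrow> c i > 0" and A: "\<And>i. i < 5 \<Longrightarrow> A i = (\<lambda>x. c i *\<^sub>R x + t i) ` K"
    using hom unfolding positive_homothetic_copy_def by metis
  obtain i j k l q where ijkl: "i < 5" "j < 5" "k < 5" "l < 5" "distinct [i, j, k, l]"
    and q: "q \<in> A i \<inter> A j \<inter> A k \<inter> A l"
    using five_touching_bodies_common_point[of A, OF body touch] by blast
  define I where "I = {i, j, k, l}"
  have I: "card I = 4" "\<And>a. a \<in> I \<Longrightarrow> a < 5" "\<And>a. a \<in> I \<Longrightarrow> q \<in> A a"
    using ijkl q by (auto simp: I_def)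
  have "\<exists>m n p r. (\<forall>s t. \<exists>x. inner m x = s \<and> inner n x = t) \<and>
    K = {x. \<bar>inner m x - p\<bar> \<le> 1 \<and> \<bar>inner n x - r\<bar> \<le> 1}"
  proof (rule parallelogram_of_four_homothets_at_point[OF K I(1), of c q t])
    show "c a > 0" if "a \<in> I" for a using c I(2) that by blast
    show "q \<in> (\<lambda>x. c a *\<^sub>R x + t a) ` K" if "a \<in> I" for a
      using I(3)[OF that] A[OF I(2)[OF that]] by simp
    show "interior ((\<lambda>x. c a *\<^sub>R x + t a) ` K) \<inter> interior ((\<lambda>x. c b *\<^sub>R x + t b) ` K) = {}"
      if "a \<in> I" "b \<in> I" "a \<noteq> b" for a b
      using dis[OF I(2)[OF that(1)] I(2)[OF that(2)] that(3)] A[OF I(2)[OF that(1)]] A[OF I(2)[OF that(2)]] by simp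
  qed
  then obtain m n p r where onto: "\<And>s t. \<exists>x. inner m x = s \<and> inner n x = t"
    and Keq: "K = {x. \<bar>inner m x - p\<bar> \<le> 1 \<and> \<bar>inner n x - r\<bar> \<le> 1}" by blast
  define p' r' where "p' i = c i * p + inner m (t i)" and "r' i = c i * r + inner n (t i)" for i
  have A': "A i = {x. \<bar>inner m x - p' i\<bar> \<le> c i \<and> \<bar>inner n x - r' i\<bar> \<le> c i}" if "i < 5" for i
    using homothet_of_parallelogram[OF Keq c[OF that]] A[OF that] by (simp add: p'_def r'_def)
  have meet: "A i \<inter> A j \<noteq> {}" if "i < 5" "j < 5" for i j
    using touch[OF that] body[OF that(1)] by (cases "i = j") (auto simp: touch_def convex_body_def)
  have "\<exists>i j. i < 5 \<and> j < 5 \<and> i \<noteq> j \<and>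
      interior {x. \<bar>inner m x - p' i\<bar> \<le> c i \<and> \<bar>inner n x - r' i\<bar> \<le> c i} \<inter>
      interior {x. \<bar>inner m x - p' j\<bar> \<le> c j \<and> \<bar>inner n x - r' j\<bar> \<le> c j} \<noteq> {}"
    by (rule five_boxes_overlap[OF onto c]) (use meet A' in auto)
  then obtain i j where ij: "i < 5" "j < 5" "i \<noteq> j"
      "interior {x. \<bar>inner m x - p' i\<bar> \<le> c i \<and> \<bar>inner n x - r' i\<bar> \<le> c i} \<inter>
      interior {x. \<bar>inner m x - p' j\<bar> \<le> c j \<and> \<bar>inner n x - r' j\<bar> \<le> c j} \<noteq> {}"
    by blast
  show False using dis[OF ij(1-3)] ij(4) unfolding A'[OF ij(1)] A'[OF ij(2)] by contradiction
qed

theorem theorem3: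
  fixes K :: "(real ^ 2) set"
  assumes "convex_body K"
  shows "(\<exists>F. touching_homothetic_family K F \<and> card F = 4) \<and>
         (\<forall>F. touching_homothetic_family K F \<longrightarrow> finite F \<and> card F \<le> 4)"
proof (intro conjI allI impI)
  show "\<exists>F. touching_homothetic_family K F \<and> card F = 4"
    by (rule four_touching_copies[OF assms])
  fix F assume F: "touching_homothetic_family K F"
  have "finite F \<and> card F \<le> 4"
  proof (rule ccontr)
    assume "\<not> (finite F \<and> card F \<le> 4)"
    then have "\<exists>G\<subseteq>F. finite G \<and> card G = 5"
      by (metis infinite_arbitrarily_large obtain_subset_with_card_n not_less_eq_eq eval_nat_numeral(3))
    then obtain G where G: "G \<subseteq> F" "finite G" "card G = 5" by blast
    obtain A where "bij_betw A {0..<card G} G" using ex_bij_betw_nat_finite[OF G(2)] by blast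
    then have A: "A i \<in> F" "j < 5 \<Longrightarrow> i \<noteq> j \<Longrightarrow> A i \<noteq> A j" if "i < 5" for i j
      using G(1,3) that unfolding bij_betw_def inj_on_def by auto
    have "\<exists>i j. i < 5 \<and> j < 5 \<and> i \<noteq> j \<and> \<not> touch (A i) (A j)"
      using F A(1) by (intro no_five_touching_copies[OF assms]) (auto simp: touching_homothetic_family_def)
    then obtain i j where ij: "i < 5" "j < 5" "i \<noteq> j" "\<not> touch (A i) (A j)" by blast
    have "touch (A i) (A j)"
      using F A(1)[OF ij(1)] A(1)[OF ij(2)] A(2)[OF ij(1-3)]
      by (auto simp: touching_homothetic_family_def dest: pairwiseD)
    then show False using ij(4) by contradiction
  qed
  then show "finite F" "card F \<le> 4" by simp_all
qed

end
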